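(* Let $h\in(0,\infty]$ and let $\omega$ be a weight function satisfying condition $(A)_h$. Then the Fréchet space $\mathcal{U}_\omega(V_h)$ satisfies $(\Omega)$.
   Context: A weight function is an increasing continuous function $\omega:[0,\infty)\to[0,\infty)$ with $\omega(0)=0$ and $\log t=o(\omega(t))$ as $t\to\infty$; in particular $\omega$ is a bijection of $[0,\infty)$. It is extended to $\mathbb{R}$ by $\omega(x)=\omega(|x|)$. For $h\in(0,\infty]$, $\omega$ satisfies $(A)_h$ if for all $\mu>\pi/(2h)$ (with $\pi/(2h)=0$ for $h=\infty$) there is $C>0$ such that $\int_0^\infty\omega(t+s)e^{-\mu s}\,ds\le C(\omega(t)+1)$ for all $t\ge0$. Write $V_h=\{z\in\mathbb{C}: |\operatorname{Im}z|<h\}$, $V_\infty=\mathbb{C}$. For $k>0$ and $\lambda\in\mathbb{R}$, $\mathcal{A}_{\omega,\lambda}(V_k)$ is the Banach space of holomorphic $\varphi$ on $V_k$ with $\|\varphi\|_{k,\lambda}=\sup_{z\in V_k}|\varphi(z)|e^{\lambda\omega(\operatorname{Re}z)}<\infty$. The Fréchet space $\mathcal{U}_\omega(V_h)$ consists of all holomorphic $\varphi$ on $V_h$ with $\|\varphi\|_{k,\lambda}<\infty$ for all $0<k<h$ and all $\lambda>0$, topologized by these norms (the projective limit of the $\mathcal{A}_{\omega,\lambda}(V_k)$ as $\lambda\to\infty$, $k\to h^-$). A Fréchet space with a fundamental decreasing sequence $(U_n)_{n\in\mathbb{N}}$ of (absolutely convex) neighbourhoods of zero satisfies $(\Omega)$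 if $$\forall n\ \exists m\ge n\ \forall k\ge m\ \exists C,L>0\ \forall r>0:\quad U_m\subseteq e^{-r}U_n+Ce^{Lr}U_k.$$ *)

theory Defs
  imports "HOL-Complex_Analysis.Complex_Analysis"
    "HOL-Library.Landau_Symbols" "HOL-Library.Function_Algebras" "HOL-Library.Set_Algebras"
begin

section \<open>Condition \<open>(\<Omega>)\<close>\<close>

text \<open>
  A topological vector space is given by a topology whose \<^const>\<open>topspace\<close> is a linear subspace
  of an ambient abelian group on which the complex numbers act by \<open>smul\<close>.
\<close>

definition absolutely_convex :: "(complex \<Rightarrow> 'a::ab_group_add \<Rightarrow> 'a) \<Rightarrow> 'a set \<Rightarrow> bool" where
  "absolutely_convex smul U \<longleftrightarrow>
     (\<forall>x\<in>U. \<forall>y\<in>U. \<forall>a b. cmod a + cmod b \<le> 1 \<longrightarrow> smul a x + smul b y \<in> U)"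

definition zero_neighbourhood :: "'a::ab_group_add topology \<Rightarrow> 'a set \<Rightarrow> bool" where
  "zero_neighbourhood X U \<longleftrightarrow> U \<subseteq> topspace X \<and> (\<exists>W. openin X W \<and> 0 \<in> W \<and> W \<subseteq> U)"

definition fundamental_sequence ::
    "(complex \<Rightarrow> 'a::ab_group_add \<Rightarrow> 'a) \<Rightarrow> 'a topology \<Rightarrow> (nat \<Rightarrow> 'a set) \<Rightarrow> bool" where
  "fundamental_sequence smul X U \<longleftrightarrow>
     (\<forall>n. zero_neighbourhood X (U n) \<and> absolutely_convex smul (U n)) \<and>
     decseq U \<and>
     (\<forall>W. zero_neighbourhood X W \<longrightarrow> (\<exists>n. U n \<subseteq> W))"

definition Omega_seq :: "(complex \<Rightarrow> 'a::ab_group_add \<Rightarrow> 'a) \<Rightarrow> (nat \<Rightarrow> 'a set) \<Rightarrow> bool" where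
  "Omega_seq smul U \<longleftrightarrow>
     (\<forall>n. \<exists>m\<ge>n. \<forall>k\<ge>m. \<exists>C>0. \<exists>L>0. \<forall>r>0.
        U m \<subseteq> smul (of_real (exp (- r))) ` U n + smul (of_real (C * exp (L * r))) ` U k)"

definition satisfies_Omega :: "(complex \<Rightarrow> 'a::ab_group_add \<Rightarrow> 'a) \<Rightarrow> 'a topology \<Rightarrow> bool" where
  "satisfies_Omega smul X \<longleftrightarrow> (\<exists>U. fundamental_sequence smul X U \<and> Omega_seq smul U)"

text \<open>The condition does not depend on the choice of the fundamental sequence.\<close>

lemma satisfies_Omega_imp_Omega_seq:
  assumes "satisfies_Omega smul X" and V: "fundamental_sequence smul X V"
  shows "Omega_seq smul V"
proof -
  obtain U where U: "fundamental_sequence smul X U" and \<Omega>: "Omega_seq smul U"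
    using assms(1) unfolding satisfies_Omega_def by blast
  have UV: "\<exists>j. U j \<subseteq> V i" and VU: "\<exists>j. V j \<subseteq> U i" for i
    using U V unfolding fundamental_sequence_def by blast+
  have decU: "decseq U" and decV: "decseq V"
    using U V unfolding fundamental_sequence_def by blast+
  show ?thesis
    unfolding Omega_seq_def
  proof (intro allI)
    fix n
    obtain n' where n': "U n' \<subseteq> V n" using UV by blast
    obtain m' where m': "\<forall>k\<ge>m'. \<exists>C>0. \<exists>L>0. \<forall>r>0.
        U m' \<subseteq> smul (of_real (exp (- r))) ` U n' + smul (of_real (C * exp (L * r))) ` U k"
      using \<Omega> unfolding Omega_seq_def by meson
    obtain m0 where m0: "V m0 \<subseteq> U m'" using VU by blast
    define m where "m = max n m0"
    have Vm: "V m \<subseteq> U m'"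
      using m0 decseqD[OF decV, of m0 m] by (auto simp: m_def)
    show "\<exists>m\<ge>n. \<forall>k\<ge>m. \<exists>C>0. \<exists>L>0. \<forall>r>0.
        V m \<subseteq> smul (of_real (exp (- r))) ` V n + smul (of_real (C * exp (L * r))) ` V k"
    proof (intro exI[of _ m] conjI allI impI)
      show "n \<le> m" by (simp add: m_def)
      fix k
      obtain k0 where k0: "U k0 \<subseteq> V k" using UV by blast
      define k' where "k' = max m' k0"
      have k': "U k' \<subseteq> V k"
        using k0 decseqD[OF decU, of k0 k'] by (auto simp: k'_def)
      obtain C L :: real where CL: "C > 0" "L > 0" and
        sub: "\<And>r. r > 0 \<Longrightarrow>
          U m' \<subseteq> smul (of_real (exp (- r))) ` U n' + smul (of_real (C * exp (L * r))) ` U k'"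
        using m'[rule_format, of k'] by (auto simp: k'_def)
      have "V m \<subseteq> smul (of_real (exp (- r))) ` V n + smul (of_real (C * exp (L * r))) ` V k"
        if "r > 0" for r
        using Vm sub[OF that] set_plus_mono2[OF image_mono[OF n'] image_mono[OF k']] by blast
      with CL show "\<exists>C>0. \<exists>L>0. \<forall>r>0.
          V m \<subseteq> smul (of_real (exp (- r))) ` V n + smul (of_real (C * exp (L * r))) ` V k"
        by blast
    qed
  qed
qed


section \<open>Weight functions\<close>

text \<open>
  A weight function is only looked at on \<open>[0,\<infinity>)\<close>; its even extension to the real line is written
  \<open>\<omega> \<bar>x\<bar>\<close>. Nonnegativity follows from monotonicity and \<open>\<omega> 0 = 0\<close>. Increasing means strictly
  increasing, so that \<open>\<omega>\<close> is a bijection of \<open>[0,\<infinity>)\<close>.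
\<close>

definition weight_function :: "(real \<Rightarrow> real) \<Rightarrow> bool" where
  "weight_function \<omega> \<longleftrightarrow>
     strict_mono_on {0..} \<omega> \<and> continuous_on {0..} \<omega> \<and> \<omega> 0 = 0 \<and>
     (\<lambda>t. ln t) \<in> o[at_top](\<omega>)"

text \<open>
  The upper integral in \<open>[0,\<infinity>]\<close> makes convergence part of the condition. In \<^typ>\<open>ereal\<close>,
  \<open>\<pi> / (2 * \<infinity>) = 0\<close>.
\<close>

definition condition_A :: "ereal \<Rightarrow> (real \<Rightarrow> real) \<Rightarrow> bool" where
  "condition_A h \<omega> \<longleftrightarrow>
     (\<forall>\<mu>::real. ereal \<mu> > ereal pi / (2 * h) \<longrightarrow>
        (\<exists>C>0. \<forall>t\<ge>0.
           (\<integral>\<^sup>+ s\<in>{0..}. ennreal (\<omega> (t + s) * exp (- \<mu> * s)) \<partial>lborel)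
             \<le> ennreal (C * (\<omega> t + 1))))"


section \<open>The space \<open>\<U>\<^sub>\<omega>(V\<^sub>h)\<close>\<close>

definition strip :: "ereal \<Rightarrow> complex set" where
  "strip h = {z. ereal \<bar>Im z\<bar> < h}"

definition weighted_abs :: "(real \<Rightarrow> real) \<Rightarrow> real \<Rightarrow> (complex \<Rightarrow> complex) \<Rightarrow> complex \<Rightarrow> real" where
  "weighted_abs \<omega> l \<phi> z = cmod (\<phi> z) * exp (l * \<omega> \<bar>Re z\<bar>)"

text \<open>
  Meaningful only where the supremum is finite, which is required separately by
  \<^const>\<open>bdd_above\<close> below.
\<close>

definition weighted_norm ::
    "(real \<Rightarrow> real) \<Rightarrow> real \<Rightarrow> real \<Rightarrow> (complex \<Rightarrow> complex) \<Rightarrow> real" where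
  "weighted_norm \<omega> k l \<phi> = (SUP z\<in>strip (ereal k). weighted_abs \<omega> l \<phi> z)"

text \<open>
  A holomorphic function on \<open>V\<^sub>h\<close> is represented by the function on the whole plane that
  vanishes off \<open>V\<^sub>h\<close>.
\<close>

definition U_space :: "(real \<Rightarrow> real) \<Rightarrow> ereal \<Rightarrow> (complex \<Rightarrow> complex) set" where
  "U_space \<omega> h =
     {\<phi>. \<phi> holomorphic_on strip h \<and> (\<forall>z. z \<notin> strip h \<longrightarrow> \<phi> z = 0) \<and>
         (\<forall>k l. 0 < k \<and> ereal k < h \<and> 0 < l \<longrightarrow>
            bdd_above (weighted_abs \<omega> l \<phi> ` strip (ereal k)))}"

definition U_topology :: "(real \<Rightarrow> real) \<Rightarrow> ereal \<Rightarrow> (complex \<Rightarrow> complex) topology" where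
  "U_topology \<omega> h =
     topology_generated_by
       {{\<psi> \<in> U_space \<omega> h. weighted_norm \<omega> k l (\<psi> - \<phi>) < \<epsilon>} | \<phi> k l \<epsilon>.
          \<phi> \<in> U_space \<omega> h \<and> 0 < k \<and> ereal k < h \<and> 0 < l \<and> 0 < \<epsilon>}"

definition fun_scale :: "complex \<Rightarrow> (complex \<Rightarrow> complex) \<Rightarrow> complex \<Rightarrow> complex" where
  "fun_scale c \<phi> = (\<lambda>z. c * \<phi> z)"

lemma topspace_U_topology:
  assumes "0 < h"
  shows "topspace (U_topology \<omega> h) = U_space \<omega> h"
proof -
  obtain k where k: "0 < k" "ereal k < h"
    using ereal_dense2[OF assms] by auto
  have "\<phi> \<in> topspace (U_topology \<omega> h)" if "\<phi> \<in> U_space \<omega> h" for \<phi>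
  proof -
    have "weighted_norm \<omega> k 1 (\<phi> - \<phi>) < 1"
    proof -
      have "(0::complex) \<in> strip (ereal k)" using k by (simp add: strip_def)
      then show ?thesis
        by (auto simp: weighted_norm_def weighted_abs_def image_constant_conv)
    qed
    with that k show ?thesis
      unfolding U_topology_def topology_generated_by_topspace
      using zero_less_one[where 'a = real] by blast
  qed
  then show ?thesis
    by (auto simp: U_topology_def topology_generated_by_topspace)
qed

end

theory Submission
  imports Defs "HOL-Real_Asymp.Real_Asymp" "HOL-Probability.Sinc_Integral"
begin

text \<open>
  Two parameters of a function must be improved at an exponential price: its decay \<open>l\<close> and the half-width \<open>k\<close>
  of its strip. Both are done by cutting off a power series after about \<open>r\<close>
  terms, so that the remainder is of size \<open>exp (- r)\<close> where little is demanded, and the partial sum of size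
  \<open>exp (C + L r)\<close> where much is demanded.

  The tool is a holomorphic function \<open>G\<close> on \<open>V\<^sub>k\<close>, for each \<open>k < h\<close>, with \<open>Re G\<close> bounded below and \<open>\<bar>G\<bar>\<close>
  bounded above by multiples of \<open>\<omega>(Re z) + 1\<close>. Up to an additive constant it is the convolution of \<open>\<omega>\<close>
  with \<open>1 / cosh (a z)\<close>, which condition \<open>(A)\<^sub>h\<close> makes converge (\<open>exists_weight_comparable\<close>).

  Decay: for \<open>X = d G\<close> with a small constant \<open>d\<close>, the function
  \<open>\<eta> = exp (- X) (\<Sum>j<N. X ^ j / fact j)\<close> with \<open>N\<close> about \<open>r\<close> satisfies \<open>\<bar>1 - \<eta>\<bar> \<le> exp (\<omega> - r)\<close> and
  \<open>\<bar>\<eta>\<bar> \<le> exp (C + L r - \<delta> \<omega>)\<close>. Splitting \<open>\<phi> = \<phi> (1 - \<eta>) + \<phi> \<eta>\<close> gains the decay \<open>\<delta>\<close>, independent of the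
  decay already present, so finitely many such steps reach any decay (\<open>splits_decay\<close>).

  Width: dividing by \<open>exp (- \<Lambda> G)\<close> reduces the problem to functions with quadratic decay. The Cauchy
  integral over the boundary of a strip writes such a function as a sum of two Cauchy transforms, and
  the poles of the Cauchy kernel are moved away from the strip by a truncated geometric series
  (\<open>strip_approximation\<close>). This step needs an initial decay that depends on the target
  strip, which is why it comes second (\<open>splits_condition_A\<close>).

  These decompositions produce functions on \<open>V\<^sub>k\<close> with \<open>k < h\<close> only. They also give the density
  that a Mittag-Leffler procedure requires; it moves the large summand into the Frechet space
  at the cost of an arbitrarily small additional error (\<open>U_space_approximation\<close>).
\<close>


section \<open>Weighted balls on strips\<close>

lemma strip_mono: "k \<le> k' \<Longrightarrow> strip k \<subseteq> strip k'"
  unfolding strip_def using order_less_le_trans by blast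

lemma mem_strip_ereal [simp]: "z \<in> strip (ereal k) \<longleftrightarrow> \<bar>Im z\<bar> < k"
  by (simp add: strip_def)

lemma open_strip: "open (strip h)"
proof (cases h)
  case (real k)
  have "strip h = {z. \<bar>Im z\<bar> < k}" by (auto simp: real strip_def)
  also have "open \<dots>" by (intro open_Collect_less continuous_intros)
  finally show ?thesis .
qed (auto simp: strip_def)

lemma weight_nonneg:
  assumes "weight_function \<omega>" "0 \<le> t"
  shows "0 \<le> \<omega> t"
proof -
  have "mono_on {0..} \<omega>"
    using assms(1) by (simp add: weight_function_def strict_mono_on_imp_mono_on)
  then have "\<omega> 0 \<le> \<omega> t" using assms(2) by (auto simp: mono_on_def)
  then show ?thesis using assms(1) by (simp add: weight_function_def)
qed

lemma weight_mono:
  assumes "weight_function \<omega>" "0 \<le> s" "s \<le> t"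
  shows "\<omega> s \<le> \<omega> t"
proof -
  have "mono_on {0..} \<omega>"
    using assms(1) by (simp add: weight_function_def strict_mono_on_imp_mono_on)
  then show ?thesis using assms(2,3) by (auto simp: mono_on_def)
qed

lemma weight_continuous:
  assumes "weight_function \<omega>"
  shows "continuous_on UNIV (\<lambda>s. \<omega> \<bar>s\<bar>)"
proof -
  have "continuous_on {0..} \<omega>" using assms by (simp add: weight_function_def)
  then show ?thesis
    by (rule continuous_on_compose2) (auto intro!: continuous_intros)
qed

text \<open>
  This is where \<open>log t = o(\<omega>(t))\<close> enters: a factor \<open>exp (- 2 \<omega>)\<close> makes a bounded function integrable
  along horizontal lines.
\<close>

lemma weight_dominates_squares:
  assumes w: "weight_function \<omega>"
  obtains B where "0 < B" "\<And>x. exp (- 2 * \<omega> \<bar>x\<bar>) \<le> B / (1 + x\<^sup>2)"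
proof -
  have "(\<lambda>t. ln t) \<in> o[at_top](\<omega>)" using w by (simp add: weight_function_def)
  from landau_o.smallD[OF this zero_less_one]
  obtain T0 where T0: "\<And>t. T0 \<le> t \<Longrightarrow> \<bar>ln t\<bar> \<le> \<bar>\<omega> t\<bar>"
    by (auto simp: eventually_at_top_linorder)
  define T where "T = max 1 T0"
  have "exp (- 2 * \<omega> \<bar>x\<bar>) \<le> (1 + T\<^sup>2 + 1) / (1 + x\<^sup>2)" for x
  proof -
    have w0: "0 \<le> \<omega> \<bar>x\<bar>" using weight_nonneg[OF w] by simp
    have "exp (- 2 * \<omega> \<bar>x\<bar>) * (1 + x\<^sup>2) \<le> 1 + T\<^sup>2 + 1"
    proof (cases "\<bar>x\<bar> \<le> T")
      case True
      then have "x\<^sup>2 \<le> T\<^sup>2" using power_mono[of "\<bar>x\<bar>" T 2] by simp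
      have "exp (- 2 * \<omega> \<bar>x\<bar>) * (1 + x\<^sup>2) \<le> 1 * (1 + x\<^sup>2)"
        using w0 by (intro mult_right_mono) auto
      also have "\<dots> \<le> 1 + T\<^sup>2 + 1" using \<open>x\<^sup>2 \<le> T\<^sup>2\<close> by simp
      finally show ?thesis .
    next
      case False
      then have x: "1 \<le> \<bar>x\<bar>" "T0 \<le> \<bar>x\<bar>" by (auto simp: T_def)
      have "ln \<bar>x\<bar> \<le> \<omega> \<bar>x\<bar>" using T0[OF x(2)] x(1) w0 by simp
      then have "exp (ln \<bar>x\<bar>) \<le> exp (\<omega> \<bar>x\<bar>)" by simp
      then have "\<bar>x\<bar> \<le> exp (\<omega> \<bar>x\<bar>)" using x by simp
      then have "\<bar>x\<bar>\<^sup>2 \<le> (exp (\<omega> \<bar>x\<bar>))\<^sup>2" by (intro power_mono) auto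
      then have "x\<^sup>2 \<le> exp (2 * \<omega> \<bar>x\<bar>)" by (simp add: exp_double)
      then have "exp (- 2 * \<omega> \<bar>x\<bar>) * x\<^sup>2 \<le> exp (- 2 * \<omega> \<bar>x\<bar>) * exp (2 * \<omega> \<bar>x\<bar>)"
        by (intro mult_left_mono) auto
      also have "\<dots> = 1" by (simp flip: exp_add)
      finally have "exp (- 2 * \<omega> \<bar>x\<bar>) * x\<^sup>2 \<le> 1" .
      moreover have "exp (- 2 * \<omega> \<bar>x\<bar>) \<le> 1" using w0 by simp
      ultimately show ?thesis
        unfolding distrib_left mult_1_right using zero_le_power2[of T] by linarith
    qed
    then show ?thesis by (simp add: pos_le_divide_eq add_pos_nonneg)
  qed
  moreover have "0 < 1 + T\<^sup>2 + 1" by (simp add: add_pos_nonneg)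
  ultimately show ?thesis by (rule that[rotated])
qed

lemma cmod_le_weighted_abs:
  assumes "weight_function \<omega>" "0 \<le> l"
  shows "cmod (\<phi> z) \<le> weighted_abs \<omega> l \<phi> z"
  using mult_left_mono[of 1 "exp (l * \<omega> \<bar>Re z\<bar>)" "cmod (\<phi> z)"]
    assms(2) weight_nonneg[OF assms(1), of "\<bar>Re z\<bar>"]
  by (simp add: weighted_abs_def)

text \<open>
  The radius is written as \<open>exp x\<close>: all error and growth bounds below are then affine in the
  exponent \<open>r\<close> of \<open>(\<Omega>)\<close>, and composing decompositions amounts to composing affine maps.
\<close>

definition weighted_ball ::
    "(real \<Rightarrow> real) \<Rightarrow> real \<Rightarrow> real \<Rightarrow> real \<Rightarrow> (complex \<Rightarrow> complex) set" where
  "weighted_ball \<omega> k l x =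
     {\<phi>. \<phi> holomorphic_on strip (ereal k) \<and>
         (\<forall>z\<in>strip (ereal k). weighted_abs \<omega> l \<phi> z \<le> exp x)}"

lemma weighted_ball_mono:
  assumes "weight_function \<omega>" "\<phi> \<in> weighted_ball \<omega> k l x" "k' \<le> k" "l' \<le> l" "x \<le> x'"
  shows "\<phi> \<in> weighted_ball \<omega> k' l' x'"
proof -
  have sub: "strip (ereal k') \<subseteq> strip (ereal k)" using assms(3) by (intro strip_mono) simp
  have "weighted_abs \<omega> l' \<phi> z \<le> exp x'" if "z \<in> strip (ereal k')" for z
  proof -
    have "weighted_abs \<omega> l' \<phi> z \<le> weighted_abs \<omega> l \<phi> z"
      unfolding weighted_abs_def
      using assms(4) weight_nonneg[OF assms(1), of "\<bar>Re z\<bar>"]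
      by (intro mult_left_mono) (simp_all add: mult_right_mono)
    also have "\<dots> \<le> exp x" using assms(2) sub that by (auto simp: weighted_ball_def)
    also have "\<dots> \<le> exp x'" using assms(5) by simp
    finally show ?thesis .
  qed
  then show ?thesis using assms(2) sub holomorphic_on_subset by (auto simp: weighted_ball_def)
qed

text \<open>
  Since \<open>2 \<le> e\<close>, a loss of one in the exponent absorbs the sum of two error terms.
\<close>

lemma exp_add_exp_le:
  fixes x :: real
  assumes "x \<le> y - 1" "x' \<le> y - 1"
  shows "exp x + exp x' \<le> exp y"
proof -
  have "exp x \<le> exp (y - 1)" "exp x' \<le> exp (y - 1)" using assms by auto
  then have "exp x + exp x' \<le> 2 * exp (y - 1)" by linarith
  also have "\<dots> \<le> exp 1 * exp (y - 1)"
    using exp_ge_add_one_self[of 1] by (intro mult_right_mono) auto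
  also have "\<dots> = exp y" by (simp flip: exp_add)
  finally show ?thesis .
qed

lemma weighted_ball_add:
  assumes "\<phi> \<in> weighted_ball \<omega> k l x" "\<psi> \<in> weighted_ball \<omega> k l x'"
    and "x \<le> y - 1" "x' \<le> y - 1"
  shows "\<phi> + \<psi> \<in> weighted_ball \<omega> k l y"
proof -
  have "weighted_abs \<omega> l (\<phi> + \<psi>) z \<le> exp y" if "z \<in> strip (ereal k)" for z
  proof -
    have "weighted_abs \<omega> l (\<phi> + \<psi>) z \<le> weighted_abs \<omega> l \<phi> z + weighted_abs \<omega> l \<psi> z"
      by (simp add: weighted_abs_def norm_triangle_ineq flip: distrib_right)
    also have "\<dots> \<le> exp x + exp x'"
      using assms(1,2) that by (intro add_mono) (auto simp: weighted_ball_def)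
    also have "\<dots> \<le> exp y" using assms(3,4) by (rule exp_add_exp_le)
    finally show ?thesis .
  qed
  then show ?thesis
    using assms(1,2) by (auto simp: weighted_ball_def plus_fun_def intro: holomorphic_intros)
qed

lemma weighted_ball_minus_commute:
  assumes "\<phi> - \<psi> \<in> weighted_ball \<omega> k l x"
  shows "\<psi> - \<phi> \<in> weighted_ball \<omega> k l x"
proof -
  have "\<psi> - \<phi> = (\<lambda>z. - (\<phi> - \<psi>) z)" by auto
  with assms holomorphic_on_minus[of "\<phi> - \<psi>" "strip (ereal k)"] show ?thesis
    by (auto simp: weighted_ball_def weighted_abs_def norm_minus_commute)
qed

lemma weighted_ball_scale:
  assumes "\<phi> \<in> weighted_ball \<omega> k l x"
  shows "fun_scale (of_real (exp y)) \<phi> \<in> weighted_ball \<omega> k l (x + y)"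
  using assms
proof -
  have "weighted_abs \<omega> l (fun_scale (of_real (exp y)) \<phi>) z = weighted_abs \<omega> l \<phi> z * exp y" for z
    by (simp add: weighted_abs_def fun_scale_def norm_mult)
  then show ?thesis
    using assms by (auto simp: weighted_ball_def fun_scale_def exp_add intro!: holomorphic_intros)
qed


section \<open>Decompositions with exponential bounds\<close>

text \<open>
  The estimate behind \<open>(\<Omega>)\<close> for three Banach spaces instead of neighbourhoods in the Frechet space:
  the unit ball with parameters \<open>(k, l)\<close> is contained in \<open>exp (- r)\<close> times the ball for \<open>(k0, l0)\<close> plus
  \<open>exp (C + L r)\<close> times the ball for \<open>(k1, l1)\<close>. The functions live on strips only, so the second
  summand need not extend to the whole of \<open>V\<^sub>h\<close>.
\<close>

definition splits ::
    "(real \<Rightarrow> real) \<Rightarrow> real \<Rightarrow> real \<Rightarrow> real \<Rightarrow> real \<Rightarrow> real \<Rightarrow> real \<Rightarrow> bool" where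
  "splits \<omega> k l k0 l0 k1 l1 \<longleftrightarrow>
     (\<exists>C\<ge>0. \<exists>L\<ge>0. \<forall>r\<ge>0. \<forall>\<phi>\<in>weighted_ball \<omega> k l 0.
        \<exists>\<psi>\<in>weighted_ball \<omega> k1 l1 (C + L * r). \<phi> - \<psi> \<in> weighted_ball \<omega> k0 l0 (- r))"

text \<open>
  The same estimate for a ball of arbitrary radius, by homogeneity.
\<close>

lemma splitsE:
  assumes "splits \<omega> k l k0 l0 k1 l1"
  obtains C L where "0 \<le> C" "0 \<le> L"
    "\<And>r x \<phi>. 0 \<le> r + x \<Longrightarrow> \<phi> \<in> weighted_ball \<omega> k l x \<Longrightarrow>
       \<exists>\<psi>\<in>weighted_ball \<omega> k1 l1 (x + C + L * (r + x)). \<phi> - \<psi> \<in> weighted_ball \<omega> k0 l0 (- r)"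
proof -
  obtain C L where CL: "0 \<le> C" "0 \<le> L" and
    *: "\<And>r \<phi>. 0 \<le> r \<Longrightarrow> \<phi> \<in> weighted_ball \<omega> k l 0 \<Longrightarrow>
        \<exists>\<psi>\<in>weighted_ball \<omega> k1 l1 (C + L * r). \<phi> - \<psi> \<in> weighted_ball \<omega> k0 l0 (- r)"
    using assms unfolding splits_def by blast
  have "\<exists>\<psi>\<in>weighted_ball \<omega> k1 l1 (x + C + L * (r + x)). \<phi> - \<psi> \<in> weighted_ball \<omega> k0 l0 (- r)"
    if r: "0 \<le> r + x" and \<phi>: "\<phi> \<in> weighted_ball \<omega> k l x" for r x \<phi>
  proof -
    have "fun_scale (of_real (exp (- x))) \<phi> \<in> weighted_ball \<omega> k l 0"
      using weighted_ball_scale[OF \<phi>, of "- x"] by simp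
    from *[OF r this] obtain \<psi> where \<psi>: "\<psi> \<in> weighted_ball \<omega> k1 l1 (C + L * (r + x))"
      "fun_scale (of_real (exp (- x))) \<phi> - \<psi> \<in> weighted_ball \<omega> k0 l0 (- (r + x))" by blast
    have "fun_scale (of_real (exp x)) (fun_scale (of_real (exp (- x))) \<phi> - \<psi>)
        = \<phi> - fun_scale (of_real (exp x)) \<psi>"
    proof
      fix z
      have "of_real (exp x) * of_real (exp (- x)) = (1 :: complex)"
        by (simp flip: of_real_mult exp_add)
      then show "fun_scale (of_real (exp x)) (fun_scale (of_real (exp (- x))) \<phi> - \<psi>) z
          = (\<phi> - fun_scale (of_real (exp x)) \<psi>) z"
        by (simp add: fun_scale_def right_diff_distrib flip: mult.assoc)
    qed
    with weighted_ball_scale[OF \<psi>(1), of x] weighted_ball_scale[OF \<psi>(2), of x]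
    show ?thesis by (auto simp: add_ac)
  qed
  with CL show ?thesis using that by blast
qed

text \<open>
  Approximating the large summand once more, with an error so small that its own size is compensated,
  multiplies its exponent by a constant only. Hence a gain in the target space that
  is independent of the current parameters can be iterated, with the same error space throughout.
\<close>

lemma splits_trans:
  assumes w: "weight_function \<omega>"
    and 1: "splits \<omega> k l k0 l0 k1 l1" and 2: "splits \<omega> k1 l1 k0' l0' k2 l2"
    and le: "k0 \<le> k0'" "l0 \<le> l0'"
  shows "splits \<omega> k l k0 l0 k2 l2"
proof -
  obtain C L where CL: "0 \<le> C" "0 \<le> L" and
    D: "\<And>r x \<phi>. 0 \<le> r + x \<Longrightarrow> \<phi> \<in> weighted_ball \<omega> k l x \<Longrightarrow>
      \<exists>\<psi>\<in>weighted_ball \<omega> k1 l1 (x + C + L * (r + x)). \<phi> - \<psi> \<in> weighted_ball \<omega> k0 l0 (- r)"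
    by (rule splitsE[OF 1]) blast
  obtain C' L' where CL': "0 \<le> C'" "0 \<le> L'" and
    D': "\<And>r x \<phi>. 0 \<le> r + x \<Longrightarrow> \<phi> \<in> weighted_ball \<omega> k1 l1 x \<Longrightarrow>
      \<exists>\<psi>\<in>weighted_ball \<omega> k2 l2 (x + C' + L' * (r + x)). \<phi> - \<psi> \<in> weighted_ball \<omega> k0' l0' (- r)"
    by (rule splitsE[OF 2]) blast
  show ?thesis
    unfolding splits_def
  proof (rule exI[of _ "C + L + C' + L' * (1 + C + L)"], rule conjI[rotated],
      rule exI[of _ "L + L' * (1 + L)"], rule conjI[rotated], intro allI impI ballI)
    fix r \<phi> assume r: "0 \<le> (r::real)" and \<phi>: "\<phi> \<in> weighted_ball \<omega> k l 0"
    define x where "x = C + L * (r + 1)"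
    have x: "0 \<le> x" using CL r by (simp add: x_def)
    obtain \<psi> where \<psi>: "\<psi> \<in> weighted_ball \<omega> k1 l1 x" "\<phi> - \<psi> \<in> weighted_ball \<omega> k0 l0 (- (r + 1))"
      using D[of "r + 1" 0 \<phi>] \<phi> r by (auto simp: x_def)
    obtain \<psi>' where \<psi>': "\<psi>' \<in> weighted_ball \<omega> k2 l2 (x + C' + L' * (r + 1 + x))"
      "\<psi> - \<psi>' \<in> weighted_ball \<omega> k0' l0' (- (r + 1))"
      using D'[of "r + 1" x \<psi>] \<psi> r x by auto
    have "\<psi> - \<psi>' \<in> weighted_ball \<omega> k0 l0 (- (r + 1))"
      using weighted_ball_mono[OF w \<psi>'(2) le] by simp
    from weighted_ball_add[OF \<psi>(2) this, of "- r"]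
    have "\<phi> - \<psi>' \<in> weighted_ball \<omega> k0 l0 (- r)" by (simp add: add_diff_eq)
    moreover have "x + C' + L' * (r + 1 + x)
        = C + L + C' + L' * (1 + C + L) + (L + L' * (1 + L)) * r"
      by (simp add: x_def algebra_simps)
    ultimately show "\<exists>\<psi>\<in>weighted_ball \<omega> k2 l2 (C + L + C' + L' * (1 + C + L) + (L + L' * (1 + L)) * r).
        \<phi> - \<psi> \<in> weighted_ball \<omega> k0 l0 (- r)" using \<psi>'(1) by metis
  qed (use CL CL' in auto)
qed

text \<open>
  The function itself serves as the large summand, and the error is zero.
\<close>

lemma splits_trivial:
  assumes "weight_function \<omega>" "k1 \<le> k" "l1 \<le> l"
  shows "splits \<omega> k l k0 l0 k1 l1"
  unfolding splits_def
proof (rule exI[of _ 0], rule conjI, simp, rule exI[of _ 0], rule conjI, simp, intro allI impI ballI)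
  fix r :: real and \<phi> assume "\<phi> \<in> weighted_ball \<omega> k l 0"
  then have "\<phi> \<in> weighted_ball \<omega> k1 l1 (0 + 0 * r)"
    using weighted_ball_mono[OF assms(1) _ assms(2,3)] by simp
  moreover have "\<phi> - \<phi> \<in> weighted_ball \<omega> k0 l0 (- r)"
    by (simp add: weighted_ball_def weighted_abs_def zero_fun_def)
  ultimately show "\<exists>\<psi>\<in>weighted_ball \<omega> k1 l1 (0 + 0 * r). \<phi> - \<psi> \<in> weighted_ball \<omega> k0 l0 (- r)" by blast
qed

lemma splits_error_mono:
  assumes "weight_function \<omega>" "splits \<omega> k l k0 l0 k1 l1" "k0' \<le> k0" "l0' \<le> l0"
  shows "splits \<omega> k l k0' l0' k1 l1"
proof -
  obtain C L where CL: "0 \<le> C" "0 \<le> L" and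
    *: "\<And>r \<phi>. 0 \<le> r \<Longrightarrow> \<phi> \<in> weighted_ball \<omega> k l 0 \<Longrightarrow>
        \<exists>\<psi>\<in>weighted_ball \<omega> k1 l1 (C + L * r). \<phi> - \<psi> \<in> weighted_ball \<omega> k0 l0 (- r)"
    using assms(2) unfolding splits_def by blast
  have "\<exists>\<psi>\<in>weighted_ball \<omega> k1 l1 (C + L * r). \<phi> - \<psi> \<in> weighted_ball \<omega> k0' l0' (- r)"
    if "0 \<le> r" "\<phi> \<in> weighted_ball \<omega> k l 0" for r \<phi>
    using *[OF that] weighted_ball_mono[OF assms(1) _ assms(3,4) order_refl] by blast
  then show ?thesis unfolding splits_def using CL by blast
qed


section \<open>A holomorphic function comparable to the weight\<close>

text \<open>
  The Cauchy estimate turns the locally uniform majorant of the integrand into a majorant of its difference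
  quotients, so that dominated convergence allows differentiation under the integral sign.
\<close>

lemma holomorphic_on_lebesgue_integral:
  fixes f :: "'a \<Rightarrow> complex \<Rightarrow> complex"
  assumes S: "open S"
    and hol: "\<And>s. f s holomorphic_on S"
    and meas: "\<And>z. z \<in> S \<Longrightarrow> (\<lambda>s. f s z) \<in> borel_measurable M"
    and dom: "\<And>z0. z0 \<in> S \<Longrightarrow>
      \<exists>\<rho>>0. \<exists>g. integrable M g \<and> (\<forall>s. \<forall>z\<in>S \<inter> cball z0 \<rho>. cmod (f s z) \<le> g s)"
  shows "(\<lambda>z. \<integral>s. f s z \<partial>M) holomorphic_on S"
proof -
  let ?F = "\<lambda>z. \<integral>s. f s z \<partial>M"
  have "(?F has_field_derivative (\<integral>s. deriv (f s) z0 \<partial>M)) (at z0)" if z0: "z0 \<in> S" for z0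
  proof -
    obtain \<rho> g where \<rho>: "0 < \<rho>" and g: "integrable M g"
      and le_g: "\<And>s z. z \<in> S \<Longrightarrow> z \<in> cball z0 \<rho> \<Longrightarrow> cmod (f s z) \<le> g s"
      using dom[OF z0] by blast
    obtain r0 where r0: "0 < r0" "cball z0 r0 \<subseteq> S" using S z0 open_contains_cball by blast
    define r where "r = min r0 \<rho> / 2"
    have r: "0 < r" "2 * r \<le> r0" "2 * r \<le> \<rho>" using r0 \<rho> by (auto simp: r_def)
    have near: "w \<in> S \<and> w \<in> cball z0 \<rho>" if "dist z0 w \<le> 2 * r" for w
      using that r r0 by auto
    have hol_ball: "f s holomorphic_on A" if "A \<subseteq> cball z0 (2 * r)" for s A
      using that near by (intro holomorphic_on_subset[OF hol]) auto
    have deriv_le: "cmod (deriv (f s) w) \<le> g s / r" if w: "w \<in> cball z0 r" for s w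
    proof -
      have sub: "cball w r \<subseteq> cball z0 (2 * r)"
        using w by (intro subsetI) (use dist_triangle_le[of z0 w] in auto, smt (verit) dist_triangle)
      have "cmod ((deriv ^^ 1) (f s) w) \<le> fact 1 * g s / r ^ 1"
      proof (rule Cauchy_inequality)
        show "f s holomorphic_on ball w r" by (rule hol_ball) (use sub in auto)
        show "continuous_on (cball w r) (f s)"
          by (rule holomorphic_on_imp_continuous_on, rule hol_ball, rule sub)
        show "cmod (f s x) \<le> g s" if "cmod (w - x) = r" for x
          using near[of x] sub that le_g by (auto simp: dist_norm subset_iff)
      qed (use r in auto)
      then show ?thesis by simp
    qed
    have lip: "cmod (f s w - f s z0) \<le> g s / r * cmod (w - z0)" if w: "w \<in> cball z0 r" for s w
    proof (rule field_differentiable_bound[of "cball z0 r" "f s" "deriv (f s)"])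
      fix u assume u: "u \<in> cball z0 r"
      then have "u \<in> S" using near[of u] r by auto
      then show "(f s has_field_derivative deriv (f s) u) (at u within cball z0 r)"
        using holomorphic_derivI[OF hol S] has_field_derivative_at_within by blast
      show "cmod (deriv (f s) u) \<le> g s / r" by (rule deriv_le[OF u])
    qed (use w r in auto)
    have int: "integrable M (\<lambda>s. f s w)" if w: "dist z0 w \<le> 2 * r" for w
    proof (rule Bochner_Integration.integrable_bound[OF g])
      show "(\<lambda>s. f s w) \<in> borel_measurable M" using near[OF w] meas by blast
      show "AE s in M. norm (f s w) \<le> norm (g s)"
        using near[OF w] le_g by (auto intro!: AE_I2 order_trans[OF _ abs_ge_self])
    qed
    show ?thesis
      unfolding has_field_derivative_iff tendsto_at_iff_sequentially
    proof (intro allI impI)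
      fix X assume X: "\<forall>i. X i \<in> UNIV - {z0}" "X \<longlonglongrightarrow> z0"
      then obtain N where N: "\<And>n. N \<le> n \<Longrightarrow> dist z0 (X n) \<le> r"
        using r(1) unfolding lim_sequentially by (metis dist_commute less_imp_le)
      have NX: "X (n + N) \<noteq> z0" "X (n + N) \<in> cball z0 r" "dist z0 (X (n + N)) \<le> 2 * r" for n
        using X N[of "n + N"] r(1) by auto
      define q where "q n s = (f s (X (n + N)) - f s z0) / (X (n + N) - z0)" for n s
      have q_meas: "q n \<in> borel_measurable M" for n
        unfolding q_def using int[OF NX(3)] int[of z0] r
        by (intro borel_measurable_divide borel_measurable_diff) auto
      have q_lim: "(\<lambda>n. q n s) \<longlonglongrightarrow> deriv (f s) z0" for s
      proof -
        have "(f s has_field_derivative deriv (f s) z0) (at z0)"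
          using holomorphic_derivI[OF hol S z0] .
        moreover have "(\<lambda>n. X (n + N)) \<longlonglongrightarrow> z0" by (rule LIMSEQ_ignore_initial_segment[OF X(2)])
        ultimately show ?thesis
          using NX(1) unfolding has_field_derivative_iff tendsto_at_iff_sequentially q_def
          by (auto simp: o_def)
      qed
      have "(\<lambda>n. integral\<^sup>L M (q n)) \<longlonglongrightarrow> (\<integral>s. deriv (f s) z0 \<partial>M)"
      proof (rule integral_dominated_convergence)
        show "(\<lambda>s. deriv (f s) z0) \<in> borel_measurable M"
          by (rule borel_measurable_LIMSEQ_metric[OF q_meas q_lim])
        show "integrable M (\<lambda>s. g s / r)" using g by simp
        show "AE s in M. norm (q n s) \<le> g s / r" for n
          using lip[OF NX(2)] NX(1)
          by (auto simp: q_def norm_divide divide_le_eq intro!: AE_I2)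
      qed (use q_meas q_lim in auto)
      moreover have "integral\<^sup>L M (q n) = (?F (X (n + N)) - ?F z0) / (X (n + N) - z0)" for n
        unfolding q_def using int[OF NX(3)] int[of z0] r by simp
      ultimately have "(\<lambda>n. (?F (X (n + N)) - ?F z0) / (X (n + N) - z0)) \<longlonglongrightarrow> (\<integral>s. deriv (f s) z0 \<partial>M)"
        by simp
      from LIMSEQ_offset[OF this[unfolded o_def]]
      show "((\<lambda>y. (?F y - ?F z0) / (y - z0)) \<circ> X) \<longlonglongrightarrow> (\<integral>s. deriv (f s) z0 \<partial>M)"
        by (auto simp: o_def intro: LIMSEQ_offset[where k = N])
    qed
  qed
  then show ?thesis using S by (auto simp: holomorphic_on_open)
qed

text \<open>
  The kernel \<open>1 / cosh w\<close> is the substitute for a Poisson kernel of the strip \<open>\<bar>Im w\<bar> < \<pi>/2\<close>: it is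
  holomorphic, and on smaller strips both its real part and its modulus are comparable to
  \<open>exp (- \<bar>Re w\<bar>)\<close>.
\<close>

lemma cosh_strip_bounds:
  fixes w :: complex
  assumes y: "\<bar>Im w\<bar> \<le> b" and b: "b < pi / 2"
  shows "cosh w \<noteq> 0"
    and "cos b * exp (- \<bar>Re w\<bar>) \<le> Re (1 / cosh w)"
    and "cmod (1 / cosh w) \<le> 2 / cos b * exp (- \<bar>Re w\<bar>)"
proof -
  let ?x = "Re w"
  have cosb: "0 < cos b" using y b by (intro cos_gt_zero_pi) auto
  have "cos b \<le> cos \<bar>Im w\<bar>" using y b by (intro cos_monotone_0_pi_le) auto
  then have cosy: "cos b \<le> cos (Im w)" by simp
  have Re_cosh: "Re (cosh w) = cosh ?x * cos (Im w)"
    by (simp add: cosh_def Re_exp field_simps)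
  have cosh_ge: "exp \<bar>?x\<bar> / 2 \<le> cosh ?x"
    by (cases "0 \<le> ?x") (auto simp: cosh_def field_simps)
  have cosh_le: "cosh ?x \<le> exp \<bar>?x\<bar>"
    by (cases "0 \<le> ?x") (auto simp: cosh_def field_simps)
  have "cosh ?x * cos b \<le> Re (cosh w)"
    unfolding Re_cosh using cosy by (intro mult_left_mono) auto
  moreover have "0 < cosh ?x" by simp
  ultimately have Re_pos: "0 < Re (cosh w)" using cosb by (smt (verit) mult_pos_pos)
  then show nz: "cosh w \<noteq> 0" by auto
  have cmod_ge: "cosh ?x * cos b \<le> cmod (cosh w)"
    using \<open>cosh ?x * cos b \<le> Re (cosh w)\<close> complex_Re_le_cmod[of "cosh w"] by linarith
  have cmod_le: "cmod (cosh w) \<le> cosh ?x"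
  proof -
    have "cmod (cosh w) \<le> (cmod (exp w) + cmod (exp (- w))) / 2"
      using norm_triangle_ineq[of "exp w" "exp (- w)"] by (simp add: cosh_def norm_divide)
    also have "\<dots> = cosh ?x" by (simp add: cosh_def)
    finally show ?thesis .
  qed
  have "Re (1 / cosh w) = Re (cosh w) / (cmod (cosh w))\<^sup>2"
    by (simp add: Re_divide cmod_power2)
  moreover have "cos b * exp (- \<bar>?x\<bar>) \<le> cosh ?x * cos b / (cosh ?x)\<^sup>2"
  proof -
    have "exp (- \<bar>?x\<bar>) \<le> 1 / cosh ?x"
      using cosh_le by (simp add: exp_minus field_simps)
    then have "cos b * exp (- \<bar>?x\<bar>) \<le> cos b * (1 / cosh ?x)"
      using cosb by (intro mult_left_mono) auto
    then show ?thesis by (simp add: power2_eq_square field_simps)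
  qed
  moreover have "cosh ?x * cos b / (cosh ?x)\<^sup>2 \<le> Re (cosh w) / (cmod (cosh w))\<^sup>2"
    using \<open>cosh ?x * cos b \<le> Re (cosh w)\<close> cmod_le nz cosb Re_pos
    by (intro frac_le power_mono) auto
  ultimately show "cos b * exp (- \<bar>?x\<bar>) \<le> Re (1 / cosh w)" by linarith
  have "exp \<bar>?x\<bar> / 2 * cos b \<le> cmod (cosh w)"
    using cmod_ge mult_right_mono[OF cosh_ge, of "cos b"] cosb by linarith
  then show "cmod (1 / cosh w) \<le> 2 / cos b * exp (- \<bar>?x\<bar>)"
    using cosb nz by (simp add: norm_divide exp_minus field_simps)
qed

text \<open>
  Condition \<open>(A)\<^sub>h\<close> bounds the convolution of the weight with \<open>exp (- a \<bar>x\<bar>)\<close>: by monotonicity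
  \<open>\<omega> \<bar>x + u\<bar> \<le> \<omega> (\<bar>x\<bar> + \<bar>u\<bar>)\<close>, and both half-lines of \<open>u\<close> contribute the integral of the condition.
\<close>

lemma weight_convolution_le:
  assumes w: "weight_function \<omega>" and C: "0 < C"
    and le: "\<And>t. 0 \<le> t \<Longrightarrow> (\<integral>\<^sup>+ s\<in>{0..}. ennreal (\<omega> (t + s) * exp (- a * s)) \<partial>lborel)
             \<le> ennreal (C * (\<omega> t + 1))"
  shows "integrable lborel (\<lambda>s. \<omega> \<bar>s\<bar> * exp (- a * \<bar>x - s\<bar>))"
    and "(\<integral>s. \<omega> \<bar>s\<bar> * exp (- a * \<bar>x - s\<bar>) \<partial>lborel) \<le> 2 * C * (\<omega> \<bar>x\<bar> + 1)"
proof -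
  have [measurable]: "(\<lambda>s. \<omega> \<bar>s\<bar>) \<in> borel_measurable borel"
    by (rule borel_measurable_continuous_onI[OF weight_continuous[OF w]])
  have nonneg: "0 \<le> \<omega> \<bar>s\<bar>" for s using weight_nonneg[OF w] by simp
  define \<phi> where "\<phi> u = ennreal (\<omega> \<bar>\<bar>x\<bar> + u\<bar> * exp (- a * u)) * indicator {0..} u" for u
  have [measurable]: "(\<lambda>u. \<omega> \<bar>\<bar>x\<bar> + u\<bar>) \<in> borel_measurable borel"
    by (rule measurable_compose[of "\<lambda>u. \<bar>x\<bar> + u" borel borel "\<lambda>s. \<omega> \<bar>s\<bar>"]) auto
  have [measurable]: "\<phi> \<in> borel_measurable borel" unfolding \<phi>_def by measurable
  have int_\<phi>: "(\<integral>\<^sup>+ u. \<phi> u \<partial>lborel) \<le> ennreal (C * (\<omega> \<bar>x\<bar> + 1))"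
  proof -
    have "(\<integral>\<^sup>+ u. \<phi> u \<partial>lborel) = (\<integral>\<^sup>+ s\<in>{0..}. ennreal (\<omega> (\<bar>x\<bar> + s) * exp (- a * s)) \<partial>lborel)"
      by (intro nn_integral_cong) (auto simp: \<phi>_def indicator_def)
    with le[of "\<bar>x\<bar>"] show ?thesis by simp
  qed
  have "(\<integral>\<^sup>+ s. ennreal (\<omega> \<bar>s\<bar> * exp (- a * \<bar>x - s\<bar>)) \<partial>lborel)
      = (\<integral>\<^sup>+ u. ennreal (\<omega> \<bar>x + u\<bar> * exp (- a * \<bar>u\<bar>)) \<partial>lborel)"
    by (subst nn_integral_real_affine[where t = x and c = 1]) auto
  also have "\<dots> \<le> (\<integral>\<^sup>+ u. \<phi> u + \<phi> (0 + (-1) * u) \<partial>lborel)"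
  proof (rule nn_integral_mono)
    fix u
    have "\<omega> \<bar>x + u\<bar> \<le> \<omega> (\<bar>x\<bar> + \<bar>u\<bar>)" by (rule weight_mono[OF w]) auto
    then have "ennreal (\<omega> \<bar>x + u\<bar> * exp (- a * \<bar>u\<bar>)) \<le> ennreal (\<omega> (\<bar>x\<bar> + \<bar>u\<bar>) * exp (- a * \<bar>u\<bar>))"
      by (intro ennreal_leI mult_right_mono) auto
    also have "\<dots> = \<phi> \<bar>u\<bar>" by (simp add: \<phi>_def)
    also have "\<dots> \<le> \<phi> u + \<phi> (0 + (-1) * u)"
      by (cases "0 \<le> u") (auto simp: add_increasing add_increasing2)
    finally show "ennreal (\<omega> \<bar>x + u\<bar> * exp (- a * \<bar>u\<bar>)) \<le> \<phi> u + \<phi> (0 + (-1) * u)" .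
  qed
  also have "\<dots> = (\<integral>\<^sup>+ u. \<phi> u \<partial>lborel) + (\<integral>\<^sup>+ u. \<phi> (0 + (-1) * u) \<partial>lborel)"
    by (rule nn_integral_add) auto
  also have "(\<integral>\<^sup>+ u. \<phi> (0 + (-1) * u) \<partial>lborel) = (\<integral>\<^sup>+ u. \<phi> u \<partial>lborel)"
    by (subst (2) nn_integral_real_affine[where t = 0 and c = "-1"]) auto
  also have "(\<integral>\<^sup>+ u. \<phi> u \<partial>lborel) + (\<integral>\<^sup>+ u. \<phi> u \<partial>lborel)
      \<le> ennreal (C * (\<omega> \<bar>x\<bar> + 1)) + ennreal (C * (\<omega> \<bar>x\<bar> + 1))"
    using int_\<phi> by (intro add_mono)
  also have "\<dots> = ennreal (2 * C * (\<omega> \<bar>x\<bar> + 1))"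
    using C nonneg[of x] by (subst ennreal_plus[symmetric]) (auto simp: mult.assoc)
  finally have nn: "(\<integral>\<^sup>+ s. ennreal (\<omega> \<bar>s\<bar> * exp (- a * \<bar>x - s\<bar>)) \<partial>lborel)
      \<le> ennreal (2 * C * (\<omega> \<bar>x\<bar> + 1))" .
  show "integrable lborel (\<lambda>s. \<omega> \<bar>s\<bar> * exp (- a * \<bar>x - s\<bar>))"
  proof (rule integrableI_nonneg)
    show "(\<integral>\<^sup>+ s. ennreal (\<omega> \<bar>s\<bar> * exp (- a * \<bar>x - s\<bar>)) \<partial>lborel) < \<infinity>"
      by (rule order_le_less_trans[OF nn]) simp
  qed (use nonneg in auto)
  show "(\<integral>s. \<omega> \<bar>s\<bar> * exp (- a * \<bar>x - s\<bar>) \<partial>lborel) \<le> 2 * C * (\<omega> \<bar>x\<bar> + 1)"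
    using nn C nonneg[of x] nonneg by (intro integral_real_bounded) auto
qed

text \<open>
  By monotonicity the weight is at least \<open>\<omega> \<bar>x\<bar>\<close> on the interval of length one that starts at \<open>x\<close> and points
  away from the origin.
\<close>

lemma weight_convolution_ge:
  assumes w: "weight_function \<omega>" and a: "0 \<le> a"
    and int: "integrable lborel (\<lambda>s. \<omega> \<bar>s\<bar> * exp (- a * \<bar>x - s\<bar>))"
  shows "exp (- a) * \<omega> \<bar>x\<bar> \<le> (\<integral>s. \<omega> \<bar>s\<bar> * exp (- a * \<bar>x - s\<bar>) \<partial>lborel)"
proof -
  define I where "I = (if 0 \<le> x then {x..x + 1} else {x - 1..x})"
  have I: "emeasure lborel I = 1" "measure lborel I = 1" "I \<in> sets borel" by (auto simp: I_def)
  have "exp (- a) * \<omega> \<bar>x\<bar> = (\<integral>s. (exp (- a) * \<omega> \<bar>x\<bar>) * indicator I s \<partial>lborel)"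
    using I by simp
  also have "\<dots> \<le> (\<integral>s. \<omega> \<bar>s\<bar> * exp (- a * \<bar>x - s\<bar>) \<partial>lborel)"
  proof (rule integral_mono[OF _ int])
    show "integrable lborel (\<lambda>s. (exp (- a) * \<omega> \<bar>x\<bar>) * indicator I s)"
      using I by (intro integrable_mult_right) (auto intro: integrable_real_indicator)
    fix s
    show "(exp (- a) * \<omega> \<bar>x\<bar>) * indicator I s \<le> \<omega> \<bar>s\<bar> * exp (- a * \<bar>x - s\<bar>)"
    proof (cases "s \<in> I")
      case True
      then have "\<bar>x\<bar> \<le> \<bar>s\<bar>" "\<bar>x - s\<bar> \<le> 1" by (auto simp: I_def split: if_splits)
      then have "\<omega> \<bar>x\<bar> \<le> \<omega> \<bar>s\<bar>" "exp (- a) \<le> exp (- a * \<bar>x - s\<bar>)"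
        using weight_mono[OF w, of "\<bar>x\<bar>" "\<bar>s\<bar>"] mult_left_mono[of "\<bar>x - s\<bar>" 1 a] a by auto
      then have "\<omega> \<bar>x\<bar> * exp (- a) \<le> \<omega> \<bar>s\<bar> * exp (- a * \<bar>x - s\<bar>)"
        using weight_nonneg[OF w] by (intro mult_mono) auto
      with True show ?thesis by (simp add: mult.commute)
    qed (use weight_nonneg[OF w] in auto)
  qed
  finally show ?thesis .
qed

text \<open>
  The bound on the modulus, and not only on the real part, confines the values of \<open>G\<close> to a proper
  subsector of the right half-plane, of an opening that depends on \<open>k\<close>.
\<close>

definition weight_comparable :: "(real \<Rightarrow> real) \<Rightarrow> real \<Rightarrow> (complex \<Rightarrow> complex) \<Rightarrow> bool" where
  "weight_comparable \<omega> k G \<longleftrightarrow> G holomorphic_on strip (ereal k) \<and>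
     (\<exists>c>0. \<exists>D>0. \<forall>z\<in>strip (ereal k).
        c * (\<omega> \<bar>Re z\<bar> + 1) \<le> Re (G z) \<and> cmod (G z) \<le> D * (\<omega> \<bar>Re z\<bar> + 1))"

text \<open>
  Take the convolution of \<open>\<omega>\<close> with \<open>1 / cosh (a z)\<close>, plus one. For \<open>k < k' < h\<close> and \<open>a = \<pi> / (2 k')\<close> the kernel
  is holomorphic beyond \<open>V\<^sub>k\<close>, and \<open>a > \<pi> / (2 h)\<close> is precisely the range of exponents for which
  condition \<open>(A)\<^sub>h\<close> controls the integral.
\<close>

lemma exists_weight_comparable:
  assumes w: "weight_function \<omega>" and A: "condition_A h \<omega>" and k: "0 < k" "ereal k < h"
  shows "\<exists>G. weight_comparable \<omega> k G"
proof -
  obtain k' where k': "k < k'" "ereal k' < h"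
    using ereal_dense2[OF k(2)] unfolding less_ereal.simps by blast
  define a where "a = pi / (2 * k')"
  define b where "b = a * k"
  have a: "0 < a" using k k' by (simp add: a_def)
  have b: "0 < b" "b < pi / 2" using k k' a by (auto simp: a_def b_def field_simps)
  have "ereal pi / (2 * h) < ereal a"
  proof (cases h)
    case (real c)
    have "pi / (2 * c) < pi / (2 * k')" using k k' real by (intro divide_strict_left_mono) auto
    moreover have "2 * h = ereal (2 * c)" by (metis real numeral_eq_ereal times_ereal.simps(1))
    ultimately show ?thesis using k k' real by (simp add: a_def)
  qed (use k' a in auto)
  then obtain C where C: "0 < C" and
    le: "\<And>t. 0 \<le> t \<Longrightarrow> (\<integral>\<^sup>+ s\<in>{0..}. ennreal (\<omega> (t + s) * exp (- a * s)) \<partial>lborel)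
             \<le> ennreal (C * (\<omega> t + 1))"
    using A unfolding condition_A_def by blast
  define H where "H x s = \<omega> \<bar>s\<bar> * exp (- a * \<bar>x - s\<bar>)" for x s :: real
  have H_int: "integrable lborel (H x)"
    and H_le: "integral\<^sup>L lborel (H x) \<le> 2 * C * (\<omega> \<bar>x\<bar> + 1)" for x
    unfolding H_def using weight_convolution_le[OF w C le] by auto
  have H_ge: "exp (- a) * \<omega> \<bar>x\<bar> \<le> integral\<^sup>L lborel (H x)" for x
    unfolding H_def by (intro weight_convolution_ge[OF w less_imp_le[OF a]] H_int[unfolded H_def])
  have nonneg: "0 \<le> \<omega> \<bar>s\<bar>" for s using weight_nonneg[OF w] by simp
  define K where "K s z = of_real (\<omega> \<bar>s\<bar>) * (1 / cosh (of_real a * (z - of_real s)))" for s :: real and z :: complex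
  have arg: "\<bar>Im (of_real a * (z - of_real s))\<bar> \<le> b" "\<bar>Re (of_real a * (z - of_real s))\<bar> = a * \<bar>Re z - s\<bar>"
    if "z \<in> strip (ereal k)" for z s
    using that a by (auto simp: b_def abs_mult)
  note cosh = cosh_strip_bounds[OF arg(1) b(2)]
  have K_le: "cmod (K s z) \<le> 2 / cos b * H (Re z) s" if z: "z \<in> strip (ereal k)" for s z
  proof -
    have "cmod (1 / cosh (of_real a * (z - of_real s))) \<le> 2 / cos b * exp (- (a * \<bar>Re z - s\<bar>))"
      using cosh(3)[OF z, of s] unfolding arg(2)[OF z] .
    from mult_left_mono[OF this nonneg[of s]]
    have "cmod (K s z) \<le> \<omega> \<bar>s\<bar> * (2 / cos b * exp (- (a * \<bar>Re z - s\<bar>)))"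
      unfolding K_def norm_mult using nonneg[of s] by simp
    then show ?thesis by (simp add: H_def mult_ac)
  qed
  have Re_K_ge: "cos b * H (Re z) s \<le> Re (K s z)" if z: "z \<in> strip (ereal k)" for s z
  proof -
    have "cos b * exp (- (a * \<bar>Re z - s\<bar>)) \<le> Re (1 / cosh (of_real a * (z - of_real s)))"
      using cosh(2)[OF z, of s] unfolding arg(2)[OF z] .
    from mult_left_mono[OF this nonneg[of s]]
    have "\<omega> \<bar>s\<bar> * (cos b * exp (- (a * \<bar>Re z - s\<bar>))) \<le> Re (K s z)"
      unfolding K_def by (simp only: Re_complex_of_real Im_complex_of_real times_complex.sel)
    then show ?thesis by (simp add: H_def mult_ac)
  qed
  have cosb: "0 < cos b" using b by (intro cos_gt_zero_pi) auto
  have K_meas: "(\<lambda>s. K s z) \<in> borel_measurable lborel" if z: "z \<in> strip (ereal k)" for z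
  proof -
    have "continuous_on UNIV (\<lambda>s. K s z)"
      unfolding K_def cosh_def using cosh(1)[OF z]
      by (intro continuous_intros weight_continuous[OF w]) (auto simp: cosh_def)
    then show ?thesis by (simp add: borel_measurable_continuous_onI)
  qed
  have K_int: "integrable lborel (\<lambda>s. K s z)" if z: "z \<in> strip (ereal k)" for z
  proof (rule Bochner_Integration.integrable_bound)
    show "integrable lborel (\<lambda>s. 2 / cos b * H (Re z) s)" using H_int by simp
    show "AE s in lborel. norm (K s z) \<le> norm (2 / cos b * H (Re z) s)"
      unfolding real_norm_def by (intro AE_I2 order_trans[OF K_le[OF z] abs_ge_self])
  qed (rule K_meas[OF z])
  \<comment> \<open>the summand \<open>1\<close> keeps \<open>Re G\<close> away from zero near \<open>Re z = 0\<close>, where \<open>\<omega>\<close> vanishes\<close>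
  define G where "G z = 1 + (\<integral>s. K s z \<partial>lborel)" for z
  have "(\<lambda>z. \<integral>s. K s z \<partial>lborel) holomorphic_on strip (ereal k)"
  proof (rule holomorphic_on_lebesgue_integral[OF open_strip _ K_meas])
    show "K s holomorphic_on strip (ereal k)" for s
      unfolding K_def cosh_def using cosh(1)
      by (intro holomorphic_intros) (auto simp: cosh_def)
    fix z0 assume z0: "z0 \<in> strip (ereal k)"
    have "cmod (K s z) \<le> 2 / cos b * exp a * H (Re z0) s"
      if z: "z \<in> strip (ereal k) \<inter> cball z0 1" for s z
    proof -
      have "\<bar>Re z0 - Re z\<bar> \<le> 1"
        using abs_Re_le_cmod[of "z0 - z"] z by (simp add: dist_norm)
      then have "a * \<bar>Re z0 - s\<bar> \<le> a * (1 + \<bar>Re z - s\<bar>)" using a by (intro mult_left_mono) auto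
      then have "exp (- a * \<bar>Re z - s\<bar>) \<le> exp (a + - a * \<bar>Re z0 - s\<bar>)"
        by (simp add: algebra_simps)
      then have "\<omega> \<bar>s\<bar> * exp (- a * \<bar>Re z - s\<bar>) \<le> \<omega> \<bar>s\<bar> * (exp a * exp (- a * \<bar>Re z0 - s\<bar>))"
        unfolding exp_add[symmetric] by (intro mult_left_mono nonneg)
      then have "2 / cos b * H (Re z) s \<le> 2 / cos b * (exp a * H (Re z0) s)"
        using cosb by (intro mult_left_mono) (auto simp: H_def mult_ac)
      with K_le[of z s] z show ?thesis by simp
    qed
    then show "\<exists>\<rho>>0. \<exists>g. integrable lborel g \<and>
        (\<forall>s. \<forall>z\<in>strip (ereal k) \<inter> cball z0 \<rho>. cmod (K s z) \<le> g s)"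
      using H_int[of "Re z0"] by (intro exI[of _ 1] conjI exI[of _ "\<lambda>s. 2 / cos b * exp a * H (Re z0) s"]) auto
  qed
  then have hol: "G holomorphic_on strip (ereal k)" unfolding G_def by (intro holomorphic_intros)
  define c where "c = min 1 (cos b * exp (- a))"
  define D where "D = 1 + 2 / cos b * (2 * C)"
  have cD: "0 < c" "0 < D" using cosb C by (auto simp: c_def D_def add_pos_pos)
  have "c * (\<omega> \<bar>Re z\<bar> + 1) \<le> Re (G z)" if z: "z \<in> strip (ereal k)" for z
  proof -
    have "c * (\<omega> \<bar>Re z\<bar> + 1) \<le> cos b * (exp (- a) * \<omega> \<bar>Re z\<bar>) + 1"
      using mult_right_mono[of c "cos b * exp (- a)" "\<omega> \<bar>Re z\<bar>"] nonneg[of "Re z"]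
      by (simp add: c_def distrib_left)
    also have "\<dots> \<le> cos b * integral\<^sup>L lborel (H (Re z)) + 1"
      using H_ge cosb by (intro add_mono mult_left_mono) auto
    also have "cos b * integral\<^sup>L lborel (H (Re z)) = (\<integral>s. cos b * H (Re z) s \<partial>lborel)" by simp
    also have "\<dots> \<le> (\<integral>s. Re (K s z) \<partial>lborel)"
      using H_int Re_K_ge[OF z] K_int[OF z] by (intro integral_mono) auto
    also have "\<dots> = Re (\<integral>s. K s z \<partial>lborel)" using K_int[OF z] by simp
    finally show ?thesis by (simp add: G_def)
  qed
  moreover have "cmod (G z) \<le> D * (\<omega> \<bar>Re z\<bar> + 1)" if z: "z \<in> strip (ereal k)" for z
  proof -
    have "cmod (\<integral>s. K s z \<partial>lborel) \<le> (\<integral>s. cmod (K s z) \<partial>lborel)"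
      by (rule integral_norm_bound)
    also have "\<dots> \<le> (\<integral>s. 2 / cos b * H (Re z) s \<partial>lborel)"
      using H_int K_int[OF z] K_le[OF z] by (intro integral_mono) auto
    also have "\<dots> = 2 / cos b * integral\<^sup>L lborel (H (Re z))" by simp
    also have "\<dots> \<le> 2 / cos b * (2 * C * (\<omega> \<bar>Re z\<bar> + 1))"
      using H_le cosb by (intro mult_left_mono) auto
    finally have "cmod (G z) \<le> 1 + 2 / cos b * (2 * C * (\<omega> \<bar>Re z\<bar> + 1))"
      unfolding G_def using norm_triangle_ineq[of 1 "\<integral>s. K s z \<partial>lborel"] by simp
    also have "\<dots> \<le> D * (\<omega> \<bar>Re z\<bar> + 1)"
      using nonneg[of "Re z"] by (simp add: D_def algebra_simps add_divide_distrib)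
    finally show ?thesis .
  qed
  ultimately show ?thesis using hol cD unfolding weight_comparable_def by blast
qed


section \<open>Improving the decay\<close>

lemma exp_series_sums: "(\<lambda>j. x ^ j / fact j) sums exp (x :: 'a :: {real_normed_field, banach})"
  using exp_converges[of x] by (simp add: scaleR_conv_of_real field_simps)

text \<open>
  The terms with index below \<open>N\<close> lose at most a factor \<open>A ^ N\<close> when \<open>x\<close> is replaced by \<open>x / A\<close>. The price
  \<open>A ^ N\<close> buys an exponential type as small as desired.
\<close>

lemma cmod_exp_partial_sum_le:
  assumes "1 \<le> A"
  shows "cmod (\<Sum>j<N. x ^ j / fact j) \<le> A ^ N * exp (cmod x / A)"
proof -
  have "cmod (\<Sum>j<N. x ^ j / fact j) \<le> (\<Sum>j<N. A ^ N * ((cmod x / A) ^ j / fact j))"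
  proof (rule sum_norm_le)
    fix j assume j: "j \<in> {..<N}"
    have "cmod (x ^ j / fact j) = A ^ j * ((cmod x / A) ^ j / fact j)"
      using assms by (simp add: norm_divide norm_power power_divide)
    also have "\<dots> \<le> A ^ N * ((cmod x / A) ^ j / fact j)"
      using assms j by (intro mult_right_mono power_increasing) auto
    finally show "cmod (x ^ j / fact j) \<le> A ^ N * ((cmod x / A) ^ j / fact j)" .
  qed
  also have "\<dots> = A ^ N * (\<Sum>j<N. (cmod x / A) ^ j / fact j)" by (simp add: sum_distrib_left)
  also have "(\<Sum>j<N. (cmod x / A) ^ j / fact j) \<le> exp (cmod x / A)"
    using sum_le_suminf[of "\<lambda>j. (cmod x / A) ^ j / fact j" "{..<N}"]
      exp_series_sums[of "cmod x / A"] assms by (simp add: sums_iff)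
  finally show ?thesis using assms by (simp add: mult_left_mono)
qed

text \<open>
  Dually, the terms of index at least \<open>N\<close> gain at least a factor \<open>exp N\<close> when \<open>x\<close> is replaced by \<open>e x\<close>.
\<close>

lemma cmod_exp_remainder_le:
  "cmod (exp x - (\<Sum>j<N. x ^ j / fact j)) \<le> exp (exp 1 * cmod x - real N)"
proof -
  let ?y = "exp 1 * cmod x"
  have tail: "(\<lambda>j. x ^ (j + N) / fact (j + N)) sums (exp x - (\<Sum>j<N. x ^ j / fact j))"
    using exp_series_sums[of x] sums_iff_shift[of "\<lambda>j. x ^ j / fact j" N "exp x - (\<Sum>j<N. x ^ j / fact j)"]
    by simp
  have tail': "(\<lambda>j. ?y ^ (j + N) / fact (j + N)) sums (exp ?y - (\<Sum>j<N. ?y ^ j / fact j))"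
    using exp_series_sums[of ?y] sums_iff_shift[of "\<lambda>j. ?y ^ j / fact j" N "exp ?y - (\<Sum>j<N. ?y ^ j / fact j)"]
    by simp
  have le: "cmod (x ^ (j + N) / fact (j + N)) \<le> exp (- real N) * (?y ^ (j + N) / fact (j + N))" for j
  proof -
    have "exp (- real N) * exp 1 ^ (j + N) = exp (real j)"
      by (simp add: power_add exp_minus exp_of_nat_mult[symmetric] flip: exp_of_nat_mult)
    then have "1 \<le> exp (- real N) * exp 1 ^ (j + N)" by simp
    then have "1 * (cmod x ^ (j + N) / fact (j + N)) \<le> (exp (- real N) * exp 1 ^ (j + N)) * (cmod x ^ (j + N) / fact (j + N))"
      by (intro mult_right_mono) auto
    then show ?thesis by (simp add: norm_divide norm_power power_mult_distrib)
  qed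
  have sm: "summable (\<lambda>j. exp (- real N) * (?y ^ (j + N) / fact (j + N)))"
    using tail' by (intro summable_mult) (rule sums_summable)
  have "cmod (exp x - (\<Sum>j<N. x ^ j / fact j)) = cmod (\<Sum>j. x ^ (j + N) / fact (j + N))"
    using tail by (simp add: sums_iff)
  also have "\<dots> \<le> (\<Sum>j. exp (- real N) * (?y ^ (j + N) / fact (j + N)))"
    by (rule norm_suminf_le[OF le sm])
  also have "\<dots> = exp (- real N) * (exp ?y - (\<Sum>j<N. ?y ^ j / fact j))"
    using tail' suminf_mult[of "\<lambda>j. ?y ^ (j + N) / fact (j + N)" "exp (- real N)"]
    by (simp add: sums_iff)
  also have "\<dots> \<le> exp (- real N) * exp ?y"
    by (intro mult_left_mono) (auto intro!: sum_nonneg)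
  also have "\<dots> = exp (?y - real N)" by (simp flip: exp_add)
  finally show ?thesis .
qed

text \<open>
  Multiply by \<open>\<eta> = exp (- X) (\<Sum>j<N. X ^ j / fact j)\<close>, where \<open>X\<close> is a small multiple of \<open>G\<close> and \<open>N\<close> is about
  \<open>r\<close>. The remainder of the exponential series gives \<open>\<bar>1 - \<eta>\<bar> \<le> exp (\<omega> - r)\<close>, an error which costs one
  unit of decay. The partial sum has an exponential type smaller than the decay of \<open>exp (- X)\<close>, because
  \<open>\<bar>X\<bar>\<close> is bounded by a fixed multiple of \<open>Re X\<close>; so \<open>\<eta>\<close> decays like \<open>exp (- \<delta> \<omega>)\<close> up to a
  factor \<open>A ^ N\<close>. It matters that \<open>\<delta>\<close> is the same for all \<open>l\<close>.
\<close>

lemma splits_decay_step: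
  assumes w: "weight_function \<omega>" and G: "weight_comparable \<omega> k G"
  shows "\<exists>\<delta>>0. \<forall>l. splits \<omega> k l k (l - 1) k (l + \<delta>)"
proof -
  obtain c D where cD: "0 < c" "0 < D"
    and Re_G: "\<And>z. z \<in> strip (ereal k) \<Longrightarrow> c * (\<omega> \<bar>Re z\<bar> + 1) \<le> Re (G z)"
    and cmod_G: "\<And>z. z \<in> strip (ereal k) \<Longrightarrow> cmod (G z) \<le> D * (\<omega> \<bar>Re z\<bar> + 1)"
    and hol_G: "G holomorphic_on strip (ereal k)"
    using G unfolding weight_comparable_def by blast
  \<comment> \<open>chosen so that \<open>e \<bar>X\<bar> \<le> \<omega> + 1\<close>, the exponent in the remainder bound\<close>
  define d where "d = exp (- 1) / D"
  define X where "X z = of_real d * G z" for z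
  \<comment> \<open>makes \<open>\<bar>X\<bar> / A\<close> at most half of the lower bound for \<open>Re X\<close>\<close>
  define A where "A = max 1 (2 * D / c)"
  define \<delta> where "\<delta> = d * c / 2"
  have d: "0 < d" and \<delta>: "0 < \<delta>" and A: "1 \<le> A" using cD by (auto simp: d_def \<delta>_def A_def)
  have Re_X: "2 * \<delta> * (\<omega> \<bar>Re z\<bar> + 1) \<le> Re (X z)" if "z \<in> strip (ereal k)" for z
    using mult_left_mono[OF Re_G[OF that], of d] d by (simp add: X_def \<delta>_def mult_ac)
  have cmod_X: "cmod (X z) \<le> d * D * (\<omega> \<bar>Re z\<bar> + 1)" if "z \<in> strip (ereal k)" for z
    using mult_left_mono[OF cmod_G[OF that], of d] d by (simp add: X_def norm_mult mult_ac)
  have "splits \<omega> k l k (l - 1) k (l + \<delta>)" for l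
    unfolding splits_def
  proof (rule exI[of _ "2 * ln A"], rule conjI[rotated],
      rule exI[of _ "ln A"], rule conjI[rotated], intro allI impI ballI)
    fix r :: real and \<phi> assume r: "0 \<le> r" and \<phi>: "\<phi> \<in> weighted_ball \<omega> k l 0"
    \<comment> \<open>the additional term absorbs the \<open>+ 1\<close> in \<open>e \<bar>X\<bar> \<le> \<omega> + 1\<close>\<close>
    define N where "N = nat \<lceil>r\<rceil> + 1"
    have N: "r + 1 \<le> real N" "real N \<le> r + 2" using r by (auto simp: N_def) linarith
    define \<eta> where "\<eta> z = exp (- X z) * (\<Sum>j<N. X z ^ j / fact j)" for z
    have hol: "\<eta> holomorphic_on strip (ereal k)"
      unfolding \<eta>_def X_def by (intro holomorphic_intros hol_G) auto
    have bound: "cmod (\<eta> z) \<le> exp (2 * ln A + ln A * r - \<delta> * \<omega> \<bar>Re z\<bar>)"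
      if z: "z \<in> strip (ereal k)" for z
    proof -
      have "cmod (X z) / A \<le> \<delta> * (\<omega> \<bar>Re z\<bar> + 1)"
      proof -
        have "d * D \<le> \<delta> * A" using d cD by (simp add: \<delta>_def A_def max_def field_simps)
        then have "d * D * (\<omega> \<bar>Re z\<bar> + 1) \<le> \<delta> * A * (\<omega> \<bar>Re z\<bar> + 1)"
          using weight_nonneg[OF w, of "\<bar>Re z\<bar>"] by (intro mult_right_mono) auto
        with cmod_X[OF z] A show ?thesis by (simp add: field_simps)
      qed
      then have "cmod (\<eta> z) \<le> exp (- Re (X z)) * (A ^ N * exp (\<delta> * (\<omega> \<bar>Re z\<bar> + 1)))"
        unfolding \<eta>_def norm_mult using A
        by (intro mult_mono order_trans[OF cmod_exp_partial_sum_le[OF A]]) auto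
      also have "A ^ N = exp (real N * ln A)" using A by (simp add: exp_of_nat_mult)
      also have "exp (- Re (X z)) * (exp (real N * ln A) * exp (\<delta> * (\<omega> \<bar>Re z\<bar> + 1)))
          = exp (- Re (X z) + real N * ln A + \<delta> * (\<omega> \<bar>Re z\<bar> + 1))"
        by (simp flip: exp_add)
      also have "\<dots> \<le> exp (2 * ln A + ln A * r - \<delta> * \<omega> \<bar>Re z\<bar>)"
      proof -
        have "real N * ln A \<le> (r + 2) * ln A" using N A by (intro mult_right_mono) auto
        with Re_X[OF z] \<delta> show ?thesis by (simp add: algebra_simps)
      qed
      finally show ?thesis .
    qed
    have error: "cmod (1 - \<eta> z) \<le> exp (\<omega> \<bar>Re z\<bar> - r)" if z: "z \<in> strip (ereal k)" for z
    proof -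
      have "1 - \<eta> z = exp (- X z) * (exp (X z) - (\<Sum>j<N. X z ^ j / fact j))"
        by (simp add: \<eta>_def right_diff_distrib exp_minus)
      then have "cmod (1 - \<eta> z) \<le> exp (- Re (X z)) * exp (exp 1 * cmod (X z) - real N)"
        using cmod_exp_remainder_le[of "X z" N] by (simp add: norm_mult)
      also have "\<dots> \<le> 1 * exp (\<omega> \<bar>Re z\<bar> - r)"
      proof (rule mult_mono)
        have "0 \<le> 2 * \<delta> * (\<omega> \<bar>Re z\<bar> + 1)" using \<delta> weight_nonneg[OF w, of "\<bar>Re z\<bar>"] by simp
        then show "exp (- Re (X z)) \<le> 1" using Re_X[OF z] by simp
        have "exp 1 * cmod (X z) \<le> exp 1 * (d * D * (\<omega> \<bar>Re z\<bar> + 1))"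
          using cmod_X[OF z] by (intro mult_left_mono) auto
        also have "\<dots> = \<omega> \<bar>Re z\<bar> + 1" using cD by (simp add: d_def exp_minus)
        finally show "exp (exp 1 * cmod (X z) - real N) \<le> exp (\<omega> \<bar>Re z\<bar> - r)"
          using N by simp
      qed auto
      finally show ?thesis by simp
    qed
    define \<psi> where "\<psi> z = \<phi> z * \<eta> z" for z
    have hol_\<phi>: "\<phi> holomorphic_on strip (ereal k)"
      and \<phi>_le: "\<And>z. z \<in> strip (ereal k) \<Longrightarrow> cmod (\<phi> z) * exp (l * \<omega> \<bar>Re z\<bar>) \<le> 1"
      using \<phi> by (auto simp: weighted_ball_def weighted_abs_def)
    have "weighted_abs \<omega> (l + \<delta>) \<psi> z \<le> exp (2 * ln A + ln A * r)" if z: "z \<in> strip (ereal k)" for z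
    proof -
      have "weighted_abs \<omega> (l + \<delta>) \<psi> z
          = (cmod (\<phi> z) * exp (l * \<omega> \<bar>Re z\<bar>)) * (cmod (\<eta> z) * exp (\<delta> * \<omega> \<bar>Re z\<bar>))"
        by (simp add: weighted_abs_def \<psi>_def norm_mult distrib_right exp_add mult_ac)
      also have "\<dots> \<le> 1 * (exp (2 * ln A + ln A * r - \<delta> * \<omega> \<bar>Re z\<bar>) * exp (\<delta> * \<omega> \<bar>Re z\<bar>))"
        using \<phi>_le[OF z] bound[OF z] by (intro mult_mono) auto
      also have "\<dots> = exp (2 * ln A + ln A * r)" by (simp flip: exp_add)
      finally show ?thesis .
    qed
    moreover have "weighted_abs \<omega> (l - 1) (\<phi> - \<psi>) z \<le> exp (- r)" if z: "z \<in> strip (ereal k)" for z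
    proof -
      have "cmod ((\<phi> - \<psi>) z) = cmod (\<phi> z) * cmod (1 - \<eta> z)"
        by (simp add: \<psi>_def right_diff_distrib flip: norm_mult)
      then have "weighted_abs \<omega> (l - 1) (\<phi> - \<psi>) z
          = (cmod (\<phi> z) * exp (l * \<omega> \<bar>Re z\<bar>)) * (cmod (1 - \<eta> z) * exp (- \<omega> \<bar>Re z\<bar>))"
        by (simp add: weighted_abs_def left_diff_distrib exp_diff exp_minus field_simps)
      also have "\<dots> \<le> 1 * (exp (\<omega> \<bar>Re z\<bar> - r) * exp (- \<omega> \<bar>Re z\<bar>))"
        using \<phi>_le[OF z] error[OF z] by (intro mult_mono) auto
      also have "\<dots> = exp (- r)" by (simp flip: exp_add)
      finally show ?thesis .
    qed
    ultimately show "\<exists>\<psi>\<in>weighted_ball \<omega> k (l + \<delta>) (2 * ln A + ln A * r).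
        \<phi> - \<psi> \<in> weighted_ball \<omega> k (l - 1) (- r)"
      using hol hol_\<phi>
      by (intro bexI[of _ \<psi>]) (auto simp: weighted_ball_def \<psi>_def[abs_def] fun_diff_def intro!: holomorphic_intros)
  qed (use A in auto)
  with \<delta> show ?thesis by blast
qed

text \<open>
  The steps of fixed length \<open>\<delta>\<close> reach every decay, and the error never needs more than the one unit of
  decay lost in the first step.
\<close>

lemma splits_decay:
  assumes w: "weight_function \<omega>" and G: "weight_comparable \<omega> k G"
  shows "splits \<omega> k l k (l - 1) k l'"
proof -
  obtain \<delta> where \<delta>: "0 < \<delta>" "\<And>l. splits \<omega> k l k (l - 1) k (l + \<delta>)"
    using splits_decay_step[OF w G] by blast
  have *: "splits \<omega> k l k (l - 1) k (l + real n * \<delta>)" for n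
  proof (induction n)
    case 0
    show ?case by (rule splits_trivial[OF w]) auto
  next
    case (Suc n)
    have "splits \<omega> k l k (l - 1) k (l + real n * \<delta> + \<delta>)"
      by (rule splits_trans[OF w Suc \<delta>(2)]) (use \<delta>(1) in auto)
    then show ?case by (simp add: algebra_simps)
  qed
  obtain n where "(l' - l) / \<delta> \<le> real n" using real_arch_simple by blast
  then have "l' \<le> l + real n * \<delta>" using \<delta>(1) by (simp add: field_simps)
  then show ?thesis
    by (intro splits_trans[OF w *[of n] splits_trivial[OF w]]) auto
qed


section \<open>Widening the strip\<close>

lemma integrable_inverse_1_plus_square_UNIV:
  "integrable lborel (\<lambda>x :: real. 1 / (1 + x\<^sup>2))"
  using integrable_inverse_1_plus_square by (simp add: set_integrable_def inverse_eq_divide)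

lemma integral_symmetric_intervals_tendsto:
  fixes f :: "real \<Rightarrow> complex"
  assumes f: "integrable lborel f"
  shows "(\<lambda>n. integral {- real n..real n} f) \<longlonglongrightarrow> (\<integral>x. f x \<partial>lborel)"
proof -
  have "integral {- real n..real n} f = (\<integral>x. indicator {- real n..real n} x *\<^sub>R f x \<partial>lborel)" for n
    using set_borel_integral_eq_integral(2)[of "{- real n..real n}" f] f
    by (simp add: set_integrable_def set_lebesgue_integral_def integrable_mult_indicator)
  moreover have "(\<lambda>n. \<integral>x. indicator {- real n..real n} x *\<^sub>R f x \<partial>lborel) \<longlonglongrightarrow> (\<integral>x. f x \<partial>lborel)"
  proof (rule integral_dominated_convergence[where w = "\<lambda>x. norm (f x)"])
    have "(\<lambda>n. indicator {- real n..real n} x *\<^sub>R f x) \<longlonglongrightarrow> f x" for x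
    proof (rule tendsto_eventually)
      obtain N where "\<bar>x\<bar> \<le> real N" using real_arch_simple by blast
      then show "\<forall>\<^sub>F n in sequentially. indicator {- real n..real n} x *\<^sub>R f x = f x"
        by (intro eventually_sequentiallyI[of N]) (auto simp: indicator_def)
    qed
    then show "AE x in lborel. (\<lambda>n. indicator {- real n..real n} x *\<^sub>R f x) \<longlonglongrightarrow> f x" by simp
    show "AE x in lborel. norm (indicator {- real n..real n} x *\<^sub>R f x) \<le> norm (f x)" for n
      by (auto simp: indicator_def)
  qed (use f borel_measurable_integrable[OF f] in auto)
  ultimately show ?thesis by simp
qed

lemma has_contour_integral_horizontal:
  assumes "x < y"
  shows "(f has_contour_integral I) (linepath (Complex x c) (Complex y c)) \<longleftrightarrow>
         ((\<lambda>s. f (Complex s c)) has_integral I) {x..y}"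
proof -
  have eq: "Complex s c = of_real s + Complex 0 c" for s by (simp add: complex_eq_iff)
  have lin: "linepath (Complex x c) (Complex y c) t = linepath (of_real x) (of_real y) t + Complex 0 c"
    and diff: "Complex y c - Complex x c = of_real y - of_real x" for t
    by (auto simp: linepath_def complex_eq_iff algebra_simps)
  have "(f has_contour_integral I) (linepath (Complex x c) (Complex y c)) \<longleftrightarrow>
      ((\<lambda>z. f (z + Complex 0 c)) has_contour_integral I) (linepath (of_real x) (of_real y))"
    unfolding has_contour_integral_linepath lin diff ..
  also have "\<dots> \<longleftrightarrow> ((\<lambda>s. f (of_real s + Complex 0 c)) has_integral I) {x..y}"
    using assms by (subst has_contour_integral_linepath_Reals_iff) auto
  finally show ?thesis unfolding eq[symmetric] .
qed

text \<open>
  The Cauchy formula for the rectangles of width \<open>2 n\<close>: for functions of quadratic decay the vertical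
  sides vanish in the limit.
\<close>

lemma Cauchy_integral_formula_strip:
  assumes hol: "F holomorphic_on strip (ereal a)"
    and bound: "\<And>w. w \<in> strip (ereal a) \<Longrightarrow> cmod (F w) \<le> B / (1 + (Re w)\<^sup>2)"
    and b: "b < a" and z: "\<bar>Im z\<bar> < b"
  shows "(\<integral>s. F (Complex s (- b)) / (Complex s (- b) - z) \<partial>lborel)
       - (\<integral>s. F (Complex s b) / (Complex s b - z) \<partial>lborel) = 2 * pi * \<i> * F z"
proof -
  define f where "f w = F w / (w - z)" for w
  have b0: "0 < b" using z by linarith
  have B0: "0 \<le> B"
    using bound[of 0] b b0 norm_ge_zero[of "F 0"] by (simp del: norm_ge_zero)
  define d where "d = b - \<bar>Im z\<bar>"
  have d: "0 < d" using z by (simp add: d_def)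
  have line: "(\<lambda>n. integral {- real n..real n} (\<lambda>s. f (Complex s \<sigma>))) \<longlonglongrightarrow> (\<integral>s. f (Complex s \<sigma>) \<partial>lborel)"
    if \<sigma>: "\<bar>\<sigma>\<bar> = b" for \<sigma>
  proof (rule integral_symmetric_intervals_tendsto)
    have dist: "d \<le> cmod (Complex s \<sigma> - z)" for s
      using abs_Im_le_cmod[of "Complex s \<sigma> - z"] \<sigma> by (simp add: d_def)
    then have nz: "Complex s \<sigma> - z \<noteq> 0" for s using d by (metis norm_zero not_le)
    have "continuous_on UNIV (\<lambda>s. F (Complex s \<sigma>))"
      by (rule continuous_on_compose2[OF holomorphic_on_imp_continuous_on[OF hol]])
         (use \<sigma> b in \<open>auto simp: Complex_eq intro!: continuous_intros\<close>)
    then have cont: "continuous_on UNIV (\<lambda>s. f (Complex s \<sigma>))"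
      unfolding f_def using nz by (intro continuous_intros) (auto simp: Complex_eq intro!: continuous_intros)
    show "integrable lborel (\<lambda>s. f (Complex s \<sigma>))"
    proof (rule Bochner_Integration.integrable_bound)
      show "integrable lborel (\<lambda>s. B / d * (1 / (1 + s\<^sup>2)))"
        using integrable_inverse_1_plus_square_UNIV by (rule integrable_mult_right)
      show "(\<lambda>s. f (Complex s \<sigma>)) \<in> borel_measurable lborel"
        using borel_measurable_continuous_onI[OF cont] by simp
      have "cmod (f (Complex s \<sigma>)) \<le> B / d * (1 / (1 + s\<^sup>2))" for s
      proof -
        have "cmod (f (Complex s \<sigma>)) \<le> (B / (1 + s\<^sup>2)) / d"
          unfolding f_def norm_divide using bound[of "Complex s \<sigma>"] \<sigma> b d dist[of s] B0
          by (intro frac_le) auto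
        then show ?thesis by (simp add: field_simps)
      qed
      then show "AE s in lborel. norm (f (Complex s \<sigma>)) \<le> norm (B / d * (1 / (1 + s\<^sup>2)))"
        unfolding real_norm_def by (intro AE_I2) (meson abs_ge_self order_trans)
    qed
  qed
  define V where "V x = contour_integral (linepath (Complex x (- b)) (Complex x b)) f" for x
  have V_le: "cmod (V x) \<le> 2 * b * B / (1 + x\<^sup>2)" if x: "\<bar>Re z\<bar> + 1 \<le> \<bar>x\<bar>" for x
  proof -
    have seg: "w \<in> strip (ereal a) - {z}" "Re w = x" if "w \<in> closed_segment (Complex x (- b)) (Complex x b)" for w
      using that x b b0 by (auto simp: closed_segment_same_Re closed_segment_eq_real_ivl)
    have "cmod (f w) \<le> B / (1 + x\<^sup>2)" if w: "w \<in> closed_segment (Complex x (- b)) (Complex x b)" for w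
    proof -
      have "1 \<le> \<bar>Re (w - z)\<bar>" using seg(2)[OF w] x by simp
      then have "1 \<le> cmod (w - z)" using abs_Re_le_cmod order_trans by blast
      then have "cmod (f w) \<le> (B / (1 + x\<^sup>2)) / 1"
        unfolding f_def norm_divide using bound[of w] seg[OF w] B0 by (intro frac_le) auto
      then show ?thesis by simp
    qed
    moreover have "f contour_integrable_on linepath (Complex x (- b)) (Complex x b)"
    proof (rule contour_integrable_continuous_linepath)
      have "continuous_on (strip (ereal a) - {z}) f"
        unfolding f_def
        by (intro continuous_intros continuous_on_subset[OF holomorphic_on_imp_continuous_on[OF hol]]) auto
      then show "continuous_on (closed_segment (Complex x (- b)) (Complex x b)) f"
        by (rule continuous_on_subset) (use seg in blast)
    qed
    ultimately have "cmod (V x) \<le> B / (1 + x\<^sup>2) * cmod (Complex x b - Complex x (- b))"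
      unfolding V_def using B0 by (intro contour_integral_bound_linepath) auto
    also have "cmod (Complex x b - Complex x (- b)) = 2 * b"
      using b0 by (simp add: cmod_def real_sqrt_mult)
    finally show ?thesis by (simp add: mult_ac)
  qed
  have rect: "integral {- real n..real n} (\<lambda>s. f (Complex s (- b))) + V (real n)
      - integral {- real n..real n} (\<lambda>s. f (Complex s b)) - V (- real n) = 2 * pi * \<i> * F z"
    if n: "\<bar>Re z\<bar> + 1 \<le> real n" for n
  proof -
    let ?a1 = "Complex (- real n) (- b)" and ?a2 = "Complex (real n) (- b)"
      and ?a3 = "Complex (real n) b" and ?a4 = "Complex (- real n) b"
    have n0: "- real n < real n" using n by linarith
    have box: "z \<in> box ?a1 ?a3" using n z by (auto simp: in_box_complex_iff)
    have "cbox ?a1 ?a3 \<subseteq> strip (ereal a)"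
    proof
      fix w assume "w \<in> cbox ?a1 ?a3"
      then have "- b \<le> Im w" "Im w \<le> b" by (simp_all add: in_cbox_complex_iff)
      then show "w \<in> strip (ereal a)" using b by simp
    qed
    moreover have "path_image (rectpath ?a1 ?a3) = cbox ?a1 ?a3 - box ?a1 ?a3"
      by (rule path_image_rectpath_cbox_minus_box) (use n0 b0 in simp_all)
    ultimately have img: "path_image (rectpath ?a1 ?a3) \<subseteq> strip (ereal a) - {z}"
      using box by blast
    have "convex (strip (ereal a))"
    proof -
      have "strip (ereal a) = {w. Im w < a} \<inter> {w. Im w > - a}" by auto
      then show ?thesis by (simp add: convex_Int convex_halfspace_Im_lt convex_halfspace_Im_gt)
    qed
    moreover have "z \<in> interior (strip (ereal a))"
      using z b by (simp add: interior_open[OF open_strip])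
    ultimately have "(f has_contour_integral 2 * pi * \<i> * winding_number (rectpath ?a1 ?a3) z * F z) (rectpath ?a1 ?a3)"
      unfolding f_def using img
      by (intro Cauchy_integral_formula_convex_simple[OF _ hol]) auto
    then have int: "(f has_contour_integral 2 * pi * \<i> * F z) (rectpath ?a1 ?a3)"
      by (simp add: winding_number_rectpath[OF box])
    have cont: "continuous_on (strip (ereal a) - {z}) f"
      unfolding f_def
      by (intro continuous_intros continuous_on_subset[OF holomorphic_on_imp_continuous_on[OF hol]]) auto
    have seg: "closed_segment ?a1 ?a2 \<subseteq> strip (ereal a) - {z}" "closed_segment ?a4 ?a3 \<subseteq> strip (ereal a) - {z}"
      "closed_segment ?a2 ?a3 \<subseteq> strip (ereal a) - {z}" "closed_segment ?a1 ?a4 \<subseteq> strip (ereal a) - {z}"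
      using b b0 z n by (auto simp: closed_segment_same_Re closed_segment_same_Im closed_segment_eq_real_ivl)
    note conts = seg[THEN continuous_on_subset[OF cont]]
    note ints = conts[THEN contour_integrable_continuous_linepath]
    have rev: "contour_integral (linepath ?a3 ?a4) f = - contour_integral (linepath ?a4 ?a3) f"
      "contour_integral (linepath ?a4 ?a1) f = - contour_integral (linepath ?a1 ?a4) f"
      using conts by (auto simp: closed_segment_commute intro!: contour_integral_reverse_linepath)
    have ints': "f contour_integrable_on linepath ?a3 ?a4" "f contour_integrable_on linepath ?a4 ?a1"
      using conts by (auto simp: closed_segment_commute intro!: contour_integrable_continuous_linepath)
    have "2 * pi * \<i> * F z = contour_integral (rectpath ?a1 ?a3) f"
      using int by (simp add: contour_integral_unique)
    also have "\<dots> = contour_integral (linepath ?a1 ?a2) f + (contour_integral (linepath ?a2 ?a3) f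
        + (contour_integral (linepath ?a3 ?a4) f + contour_integral (linepath ?a4 ?a1) f))"
      unfolding rectpath_def Let_def using ints ints' by simp
    finally have "2 * pi * \<i> * F z = contour_integral (linepath ?a1 ?a2) f + V (real n)
        - contour_integral (linepath ?a4 ?a3) f - V (- real n)"
      unfolding rev by (simp add: V_def)
    moreover have "contour_integral (linepath ?a1 ?a2) f = integral {- real n..real n} (\<lambda>s. f (Complex s (- b)))"
      using has_contour_integral_integral[OF ints(1)] unfolding has_contour_integral_horizontal[OF n0]
      by (simp add: integral_unique)
    moreover have "contour_integral (linepath ?a4 ?a3) f = integral {- real n..real n} (\<lambda>s. f (Complex s b))"
      using has_contour_integral_integral[OF ints(2)] unfolding has_contour_integral_horizontal[OF n0]
      by (simp add: integral_unique)
    ultimately show ?thesis by simp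
  qed
  obtain N where N: "\<bar>Re z\<bar> + 1 \<le> real N" using real_arch_simple by blast
  have ev: "\<forall>\<^sub>F n in sequentially. \<bar>Re z\<bar> + 1 \<le> real n"
    using N by (intro eventually_sequentiallyI[of N]) (meson of_nat_le_iff order_trans)
  have lim0: "(\<lambda>n. 2 * b * B / (1 + (real n)\<^sup>2)) \<longlonglongrightarrow> 0" by real_asymp
  have V1: "(\<lambda>n. V (real n)) \<longlonglongrightarrow> 0"
    by (rule Lim_null_comparison[OF _ lim0], rule eventually_mono[OF ev]) (use V_le in force)
  have V2: "(\<lambda>n. V (- real n)) \<longlonglongrightarrow> 0"
    by (rule Lim_null_comparison[OF _ lim0], rule eventually_mono[OF ev])
       (use V_le[of "- real _"] in force)
  have "(\<lambda>n. integral {- real n..real n} (\<lambda>s. f (Complex s (- b))) + V (real n)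
      - integral {- real n..real n} (\<lambda>s. f (Complex s b)) - V (- real n))
      \<longlonglongrightarrow> (\<integral>s. f (Complex s (- b)) \<partial>lborel) + 0 - (\<integral>s. f (Complex s b) \<partial>lborel) - 0"
    using b0 by (intro tendsto_intros line V1 V2) auto
  moreover have "(\<lambda>n. integral {- real n..real n} (\<lambda>s. f (Complex s (- b))) + V (real n)
      - integral {- real n..real n} (\<lambda>s. f (Complex s b)) - V (- real n)) \<longlonglongrightarrow> 2 * pi * \<i> * F z"
    by (rule tendsto_eventually, rule eventually_mono[OF ev]) (rule rect)
  ultimately show ?thesis
    using LIMSEQ_unique unfolding f_def by fastforce
qed

text \<open>
  For \<open>\<bar>c\<bar> < \<bar>u\<bar>\<close> the Cauchy kernel with pole at \<open>c\<close> is approximated by kernels with the pole moved to \<open>0\<close>.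
\<close>

lemma truncated_geometric_kernel:
  fixes u c :: complex
  assumes "u \<noteq> 0" "u \<noteq> c"
  shows "1 / (u - c) - (\<Sum>j<N. c ^ j / u ^ Suc j) = (c / u) ^ N / (u - c)"
proof -
  have "(\<Sum>j<N. c ^ j / u ^ Suc j) = (\<Sum>j<N. (c / u) ^ j) / u"
    by (simp add: sum_divide_distrib power_divide divide_divide_eq_left mult.commute)
  also have "(\<Sum>j<N. (c / u) ^ j) = (1 - (c / u) ^ N) / (1 - c / u)"
    using assms by (simp add: sum_gp_strict)
  also have "\<dots> / u = (1 - (c / u) ^ N) / (u - c)"
    using assms by (simp add: field_simps)
  finally show ?thesis by (simp flip: diff_divide_distrib)
qed

text \<open>
  The Cauchy transform of a function on the line \<open>Im z = - b'\<close> is holomorphic above that line. Moving the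
  pole of the kernel down by \<open>K\<close>, with the geometric series truncated after \<open>N\<close> terms, gives a function
  holomorphic on \<open>V\<^sub>K\<close>. The error on \<open>V\<^sub>b\<close> is geometric in \<open>N\<close> with ratio \<open>q < 1\<close>, the size on \<open>V\<^sub>K\<close> at
  most geometric in \<open>N\<close>; with \<open>N\<close> proportional to \<open>r\<close> both bounds take the required form.
\<close>

lemma cauchy_transform_approximation:
  assumes b: "0 < b" "b < b'" "b' < K"
  obtains C L where "0 \<le> C" "0 \<le> L"
    "\<And>r g. 0 \<le> r \<Longrightarrow> continuous_on UNIV g \<Longrightarrow> integrable lborel g \<Longrightarrow>
      \<exists>P. P holomorphic_on strip (ereal K) \<and>
        (\<forall>z\<in>strip (ereal K). cmod (P z) \<le> exp (C + L * r) * (\<integral>s. cmod (g s) \<partial>lborel)) \<and>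
        (\<forall>z\<in>strip (ereal b). cmod ((\<integral>s. g s / (Complex s (- b') - z) \<partial>lborel) - P z)
           \<le> exp (- r) * (\<integral>s. cmod (g s) \<partial>lborel))"
proof -
  define q where "q = K / (K + b' - b)"
  define \<theta> where "\<theta> = - ln q"
  define M where "M = ln (2 * K / b')"
  define c1 where "c1 = \<bar>ln (b' - b)\<bar>"
  define C where "C = (c1 / \<theta> + 1) * M + \<bar>ln b'\<bar>"
  define L where "L = M / \<theta>"
  have q: "0 < q" "q < 1" using b by (auto simp: q_def)
  have \<theta>: "0 < \<theta>" using q by (simp add: \<theta>_def)
  have M: "0 < M" using b by (simp add: M_def)
  have c1: "0 \<le> c1" by (simp add: c1_def)
  have CL: "0 \<le> C" "0 \<le> L" using \<theta> M c1 by (auto simp: C_def L_def)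
  have main: "\<exists>P. P holomorphic_on strip (ereal K) \<and>
      (\<forall>z\<in>strip (ereal K). cmod (P z) \<le> exp (C + L * r) * (\<integral>s. cmod (g s) \<partial>lborel)) \<and>
      (\<forall>z\<in>strip (ereal b). cmod ((\<integral>s. g s / (Complex s (- b') - z) \<partial>lborel) - P z)
         \<le> exp (- r) * (\<integral>s. cmod (g s) \<partial>lborel))"
    if r: "0 \<le> r" and cont: "continuous_on UNIV g" and int: "integrable lborel g" for r g
  proof -
    \<comment> \<open>enough terms for \<open>q ^ N / (b' - b) \<le> exp (- r)\<close>\<close>
    define N where "N = nat \<lceil>(r + c1) / \<theta>\<rceil>"
    have "0 \<le> (r + c1) / \<theta>" using r c1 \<theta> by simp
    then have N: "(r + c1) / \<theta> \<le> real N" "real N \<le> (r + c1) / \<theta> + 1"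
      unfolding N_def by linarith+
    \<comment> \<open>the Cauchy denominator with its pole shifted down by \<open>K\<close>, which keeps it away from \<open>V\<^sub>K\<close>\<close>
    define u where "u s z = Complex s (- b' - K) - z" for s z
    define c where "c = - \<i> * of_real K"
    define S where "S s z = (\<Sum>j<N. c ^ j / u s z ^ Suc j)" for s z
    have u_eq: "u s z - c = Complex s (- b') - z" for s z
      by (simp add: u_def c_def complex_eq_iff)
    have u_ge: "b' + K + Im z \<le> cmod (u s z)" for s z
      using abs_Im_le_cmod[of "u s z"] by (simp add: u_def)
    have u_ge': "b' \<le> cmod (u s z)" "u s z \<noteq> 0" if "z \<in> strip (ereal K)" for s z
      using u_ge[of z s] that b by auto
    have cmod_c: "cmod c = K" using b by (simp add: c_def norm_mult)
    have S_le: "cmod (S s z) \<le> exp (C + L * r)" if z: "z \<in> strip (ereal K)" for s z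
    proof -
      have "cmod (S s z) \<le> (\<Sum>j<N. (K / b') ^ N / b')"
        unfolding S_def
      proof (rule sum_norm_le)
        fix j assume j: "j \<in> {..<N}"
        have "cmod (c ^ j / u s z ^ Suc j) \<le> K ^ j / b' ^ Suc j"
          unfolding norm_divide norm_power cmod_c using u_ge'[OF z, of s] b
          by (intro divide_left_mono power_mono mult_pos_pos zero_less_power) auto
        also have "\<dots> = (K / b') ^ j / b'" by (simp add: power_divide mult.commute)
        also have "\<dots> \<le> (K / b') ^ N / b'"
          using b j by (intro divide_right_mono power_increasing) auto
        finally show "cmod (c ^ j / u s z ^ Suc j) \<le> (K / b') ^ N / b'" .
      qed
      also have "\<dots> = real N * ((K / b') ^ N / b')" by simp
      also have "\<dots> \<le> 2 ^ N * ((K / b') ^ N / b')"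
        using b of_nat_less_two_power[of N] by (intro mult_right_mono less_imp_le) auto
      also have "\<dots> = (2 * K / b') ^ N / b'"
        by (simp add: power_divide power_mult_distrib)
      also have "\<dots> = exp (real N * M - ln b')"
        using b by (simp add: M_def exp_diff exp_of_nat_mult)
      also have "\<dots> \<le> exp (C + L * r)"
      proof -
        have "real N * M \<le> ((r + c1) / \<theta> + 1) * M" using N M by (intro mult_right_mono) auto
        also have "\<dots> = (c1 / \<theta> + 1) * M + L * r"
          using \<theta> by (simp add: L_def field_simps)
        finally show ?thesis by (simp add: C_def)
      qed
      finally show ?thesis .
    qed
    have err: "cmod (1 / (Complex s (- b') - z) - S s z) \<le> exp (- r)" if z: "z \<in> strip (ereal b)" for s z
    proof -
      have zK: "z \<in> strip (ereal K)" using z b by simp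
      have d: "b' - b \<le> cmod (Complex s (- b') - z)"
        using abs_Im_le_cmod[of "Complex s (- b') - z"] z by simp
      then have "u s z \<noteq> c" using u_eq[of s z] b by auto
      then have "1 / (Complex s (- b') - z) - S s z = (c / u s z) ^ N / (Complex s (- b') - z)"
        using truncated_geometric_kernel[of "u s z" c N] u_ge'[OF zK] by (simp add: S_def u_eq)
      also have "cmod \<dots> \<le> q ^ N / (b' - b)"
        unfolding norm_divide norm_power cmod_c
      proof (intro frac_le power_mono)
        show "K / cmod (u s z) \<le> q"
          unfolding q_def using u_ge[of z s] z b by (intro divide_left_mono mult_pos_pos) auto
      qed (use b d q in auto)
      also have "\<dots> = exp (- (real N * \<theta>) - ln (b' - b))"
      proof -
        have "q ^ N = exp (- (real N * \<theta>))" using q by (simp add: \<theta>_def exp_of_nat_mult)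
        then show ?thesis using b by (simp add: exp_diff)
      qed
      also have "\<dots> \<le> exp (- r)"
      proof -
        have "r + c1 \<le> real N * \<theta>" using N(1) \<theta> by (simp add: field_simps)
        then show ?thesis by (simp add: c1_def)
      qed
      finally show ?thesis .
    qed
    have S_cont: "continuous_on UNIV (\<lambda>s. S s z)" if z: "z \<in> strip (ereal K)" for z
      unfolding S_def using u_ge'(2)[OF z]
      by (intro continuous_intros) (auto simp: u_def Complex_eq intro!: continuous_intros)
    have gS_meas: "(\<lambda>s. g s * S s z) \<in> borel_measurable lborel" if z: "z \<in> strip (ereal K)" for z
      using borel_measurable_continuous_onI[OF continuous_on_mult[OF cont S_cont[OF z]]] by simp
    have gS_le: "cmod (g s * S s z) \<le> exp (C + L * r) * cmod (g s)" if z: "z \<in> strip (ereal K)" for s z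
      using mult_left_mono[OF S_le[OF z, of s], of "cmod (g s)"] by (simp add: norm_mult mult.commute)
    have int': "integrable lborel (\<lambda>s. exp (C + L * r) * cmod (g s))"
      using int by (intro integrable_mult_right integrable_norm)
    have gS_int: "integrable lborel (\<lambda>s. g s * S s z)" if z: "z \<in> strip (ereal K)" for z
      by (rule Bochner_Integration.integrable_bound[OF int' gS_meas[OF z]]) (use gS_le[OF z] in auto)
    define P where "P z = (\<integral>s. g s * S s z \<partial>lborel)" for z
    have "P holomorphic_on strip (ereal K)"
      unfolding P_def
    proof (rule holomorphic_on_lebesgue_integral[OF open_strip _ gS_meas])
      show "(\<lambda>z. g s * S s z) holomorphic_on strip (ereal K)" for s
        unfolding S_def using u_ge'(2)
        by (intro holomorphic_intros) (auto simp: u_def intro!: holomorphic_intros)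
      show "\<exists>\<rho>>0. \<exists>h. integrable lborel h \<and>
          (\<forall>s. \<forall>z\<in>strip (ereal K) \<inter> cball z0 \<rho>. cmod (g s * S s z) \<le> h s)" for z0
        using int' gS_le
        by (intro exI[of _ 1] conjI exI[of _ "\<lambda>s. exp (C + L * r) * cmod (g s)"]) auto
    qed
    moreover have "cmod (P z) \<le> exp (C + L * r) * (\<integral>s. cmod (g s) \<partial>lborel)"
      if z: "z \<in> strip (ereal K)" for z
    proof -
      have "cmod (P z) \<le> (\<integral>s. cmod (g s * S s z) \<partial>lborel)"
        unfolding P_def by (rule integral_norm_bound)
      also have "\<dots> \<le> (\<integral>s. exp (C + L * r) * cmod (g s) \<partial>lborel)"
        by (rule integral_mono[OF integrable_norm[OF gS_int[OF z]] int' gS_le[OF z]])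
      finally show ?thesis by simp
    qed
    moreover have "cmod ((\<integral>s. g s / (Complex s (- b') - z) \<partial>lborel) - P z)
         \<le> exp (- r) * (\<integral>s. cmod (g s) \<partial>lborel)" if z: "z \<in> strip (ereal b)" for z
    proof -
      have zK: "z \<in> strip (ereal K)" using z b by simp
      have nz: "Complex s (- b') - z \<noteq> 0" for s
        using z b by (auto simp: complex_eq_iff)
      have E_le: "cmod (g s / (Complex s (- b') - z) - g s * S s z) \<le> exp (- r) * cmod (g s)" for s
      proof -
        have "g s / (Complex s (- b') - z) - g s * S s z = g s * (1 / (Complex s (- b') - z) - S s z)"
          by (simp add: right_diff_distrib)
        then show ?thesis
          using mult_left_mono[OF err[OF z, of s], of "cmod (g s)"] by (simp only: norm_mult mult.commute norm_ge_zero)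
      qed
      have int'': "integrable lborel (\<lambda>s. exp (- r) * cmod (g s))"
        using int by (intro integrable_mult_right integrable_norm)
      have "continuous_on UNIV (\<lambda>s. g s / (Complex s (- b') - z) - g s * S s z)"
        using nz by (intro continuous_intros cont S_cont[OF zK]) (auto simp: Complex_eq intro!: continuous_intros)
      then have E_int: "integrable lborel (\<lambda>s. g s / (Complex s (- b') - z) - g s * S s z)"
        by (intro Bochner_Integration.integrable_bound[OF int''])
           (use E_le borel_measurable_continuous_onI in auto)
      from Bochner_Integration.integrable_add[OF this gS_int[OF zK]]
      have "integrable lborel (\<lambda>s. g s / (Complex s (- b') - z))" by simp
      then have "(\<integral>s. g s / (Complex s (- b') - z) \<partial>lborel) - P z
          = (\<integral>s. g s / (Complex s (- b') - z) - g s * S s z \<partial>lborel)"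
        unfolding P_def using gS_int[OF zK] by simp
      also have "cmod \<dots> \<le> (\<integral>s. cmod (g s / (Complex s (- b') - z) - g s * S s z) \<partial>lborel)"
        by (rule integral_norm_bound)
      also have "\<dots> \<le> (\<integral>s. exp (- r) * cmod (g s) \<partial>lborel)"
        by (rule integral_mono[OF integrable_norm[OF E_int] int'' E_le])
      finally show ?thesis by simp
    qed
    ultimately show ?thesis by blast
  qed
  show ?thesis by (rule that[OF CL main])
qed

text \<open>
  For \<open>b < b' < a\<close>, the Cauchy formula on the strip of half-width \<open>b'\<close> writes \<open>F\<close> as the sum of two Cauchy transforms, of
  functions on the lower and on the upper boundary line. The substitution \<open>z \<mapsto> - z\<close> turns the second
  into one of the first kind.
\<close>

lemma strip_approximation:
  assumes b: "0 < b" "b < a" "a \<le> K" and B: "0 < B"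
  obtains C L where "0 \<le> C" "0 \<le> L"
    "\<And>r F. 0 \<le> r \<Longrightarrow> F holomorphic_on strip (ereal a) \<Longrightarrow>
      \<forall>w\<in>strip (ereal a). cmod (F w) \<le> B / (1 + (Re w)\<^sup>2) \<Longrightarrow>
      \<exists>P. P holomorphic_on strip (ereal K) \<and>
        (\<forall>z\<in>strip (ereal K). cmod (P z) \<le> exp (C + L * r)) \<and>
        (\<forall>z\<in>strip (ereal b). cmod (F z - P z) \<le> exp (- r))"
proof -
  define b' where "b' = (a + b) / 2"
  have b': "b < b'" "b' < a" "b' < K" using b by (auto simp: b'_def)
  obtain C L where CL: "0 \<le> C" "0 \<le> L" and approx:
    "\<And>r g. 0 \<le> r \<Longrightarrow> continuous_on UNIV g \<Longrightarrow> integrable lborel g \<Longrightarrow>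
    \<exists>P. P holomorphic_on strip (ereal K) \<and>
      (\<forall>z\<in>strip (ereal K). cmod (P z) \<le> exp (C + L * r) * (\<integral>s. cmod (g s) \<partial>lborel)) \<and>
      (\<forall>z\<in>strip (ereal b). cmod ((\<integral>s. g s / (Complex s (- b') - z) \<partial>lborel) - P z)
         \<le> exp (- r) * (\<integral>s. cmod (g s) \<partial>lborel))"
    by (rule cauchy_transform_approximation[OF b(1) b'(1,3)]) (rule that)
  define J where "J = integral\<^sup>L lborel (\<lambda>s :: real. B * (1 / (1 + s\<^sup>2)))"
  have J_int: "integrable lborel (\<lambda>s :: real. B * (1 / (1 + s\<^sup>2)))"
    using integrable_inverse_1_plus_square_UNIV by (rule integrable_mult_right)
  define m where "m = \<bar>J\<bar>"
  have m: "0 \<le> m" "J \<le> exp m"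
    using exp_ge_add_one_self[of "\<bar>J\<bar>"] unfolding m_def by linarith+
  have main: "\<exists>P. P holomorphic_on strip (ereal K) \<and>
      (\<forall>z\<in>strip (ereal K). cmod (P z) \<le> exp (m + C + L * m + L * r)) \<and>
      (\<forall>z\<in>strip (ereal b). cmod (F z - P z) \<le> exp (- r))"
    if r: "0 \<le> r" and hol: "F holomorphic_on strip (ereal a)"
      and F_le: "\<forall>w\<in>strip (ereal a). cmod (F w) \<le> B / (1 + (Re w)\<^sup>2)" for r F
  proof -
    note bound = bspec[OF F_le]
    define g1 where "g1 s = F (Complex s (- b'))" for s
    \<comment> \<open>the upper boundary line, reflected at the origin\<close>
    define g2 where "g2 s = F (Complex (- s) b')" for s
    have g_le: "cmod (g1 s) \<le> B * (1 / (1 + s\<^sup>2))" "cmod (g2 s) \<le> B * (1 / (1 + s\<^sup>2))" for s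
      using bound[of "Complex s (- b')"] bound[of "Complex (- s) b'"] b b' by (auto simp: g1_def g2_def)
    note F_cont = holomorphic_on_imp_continuous_on[OF hol]
    have g_cont: "continuous_on UNIV g1" "continuous_on UNIV g2"
      unfolding g1_def g2_def using b b'
      by (auto intro!: continuous_on_compose2[OF F_cont] continuous_intros simp: Complex_eq)
    have g_int: "integrable lborel g1" "integrable lborel g2"
      using borel_measurable_continuous_onI[OF g_cont(1)] borel_measurable_continuous_onI[OF g_cont(2)]
      by (auto simp del: times_divide_eq_right abs_mult simp: real_norm_def
          intro!: Bochner_Integration.integrable_bound[OF J_int] AE_I2
            order_trans[OF g_le(1) abs_ge_self] order_trans[OF g_le(2) abs_ge_self])
    have g_norm: "(\<integral>s. cmod (g1 s) \<partial>lborel) \<le> exp m" "(\<integral>s. cmod (g2 s) \<partial>lborel) \<le> exp m"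
      using integral_mono[OF integrable_norm[OF g_int(1)] J_int g_le(1)]
        integral_mono[OF integrable_norm[OF g_int(2)] J_int g_le(2)] m(2) by (auto simp: J_def)
    have rm: "0 \<le> r + m" using r m by simp
    obtain P1 where P1: "P1 holomorphic_on strip (ereal K)"
      "\<And>z. z \<in> strip (ereal K) \<Longrightarrow> cmod (P1 z) \<le> exp (C + L * (r + m)) * (\<integral>s. cmod (g1 s) \<partial>lborel)"
      "\<And>z. z \<in> strip (ereal b) \<Longrightarrow> cmod ((\<integral>s. g1 s / (Complex s (- b') - z) \<partial>lborel) - P1 z)
         \<le> exp (- (r + m)) * (\<integral>s. cmod (g1 s) \<partial>lborel)"
      using approx[OF rm g_cont(1) g_int(1)] by blast
    obtain P2 where P2: "P2 holomorphic_on strip (ereal K)"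
      "\<And>z. z \<in> strip (ereal K) \<Longrightarrow> cmod (P2 z) \<le> exp (C + L * (r + m)) * (\<integral>s. cmod (g2 s) \<partial>lborel)"
      "\<And>z. z \<in> strip (ereal b) \<Longrightarrow> cmod ((\<integral>s. g2 s / (Complex s (- b') - z) \<partial>lborel) - P2 z)
         \<le> exp (- (r + m)) * (\<integral>s. cmod (g2 s) \<partial>lborel)"
      using approx[OF rm g_cont(2) g_int(2)] by blast
    have half: "cmod ((w1 + w2) / (2 * pi * \<i>)) \<le> y" if "cmod w1 \<le> y" "cmod w2 \<le> y" for w1 w2 y
    proof -
      have "0 \<le> y" using that(1) norm_ge_zero order_trans by blast
      have "cmod ((w1 + w2) / (2 * pi * \<i>)) = cmod (w1 + w2) / (2 * pi)"
        by (simp add: norm_divide norm_mult)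
      also have "\<dots> \<le> (y + y) / (2 * pi)"
        using that by (intro divide_right_mono norm_triangle_mono) auto
      also have "\<dots> \<le> (y + y) / 2"
        using pi_gt3 \<open>0 \<le> y\<close> by (intro divide_left_mono) auto
      finally show ?thesis by simp
    qed
    define P where "P z = (P1 z + P2 (- z)) / (2 * pi * \<i>)" for z
    have "(P2 \<circ> uminus) holomorphic_on strip (ereal K)"
      by (rule holomorphic_on_compose_gen[OF _ P2(1)]) (auto intro!: holomorphic_intros)
    then have "P holomorphic_on strip (ereal K)"
      unfolding P_def using P1(1) by (auto intro!: holomorphic_intros simp: o_def)
    moreover have "cmod (P z) \<le> exp (m + C + L * m + L * r)" if z: "z \<in> strip (ereal K)" for z
    proof -
      have *: "exp (C + L * (r + m)) * x \<le> exp (m + C + L * m + L * r)" if "x \<le> exp m" for x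
      proof -
        have "exp (C + L * (r + m)) * x \<le> exp (C + L * (r + m)) * exp m"
          using that by (intro mult_left_mono) auto
        also have "\<dots> = exp (m + C + L * m + L * r)" by (simp add: algebra_simps flip: exp_add)
        finally show ?thesis .
      qed
      show ?thesis
        unfolding P_def
        by (intro half order_trans[OF P1(2)[OF z]] order_trans[OF P2(2)] * g_norm) (use z in simp)
    qed
    moreover have "cmod (F z - P z) \<le> exp (- r)" if z: "z \<in> strip (ereal b)" for z
    proof -
      let ?Q1 = "\<integral>s. g1 s / (Complex s (- b') - z) \<partial>lborel"
      let ?Q2 = "\<integral>s. g2 s / (Complex s (- b') - (- z)) \<partial>lborel"
      have "(\<integral>s. F (Complex s b') / (Complex s b' - z) \<partial>lborel)
          = (\<integral>s. F (Complex (0 + (- 1) * s) b') / (Complex (0 + (- 1) * s) b' - z) \<partial>lborel)"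
        by (subst lborel_integral_real_affine[where t = 0 and c = "- 1"]) auto
      also have "\<dots> = (\<integral>s. - (g2 s / (Complex s (- b') - (- z))) \<partial>lborel)"
      proof (intro Bochner_Integration.integral_cong refl)
        fix s
        have "Complex (0 + (- 1) * s) b' - z = - (Complex s (- b') - (- z))"
          by (simp add: complex_eq_iff)
        then show "F (Complex (0 + (- 1) * s) b') / (Complex (0 + (- 1) * s) b' - z)
            = - (g2 s / (Complex s (- b') - (- z)))"
          by (simp only: g2_def divide_minus_right) simp
      qed
      also have "\<dots> = - ?Q2" by (rule Bochner_Integration.integral_minus)
      finally have "2 * pi * \<i> * F z = ?Q1 + ?Q2"
        using Cauchy_integral_formula_strip[OF hol, of B b' z] bound b'(1,2) z
        by (simp add: g1_def)
      then have "F z = (?Q1 + ?Q2) / (2 * pi * \<i>)"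
        by (simp add: field_simps)
      then have "F z - P z = ((?Q1 - P1 z) + (?Q2 - P2 (- z))) / (2 * pi * \<i>)"
        by (simp add: P_def diff_divide_distrib add_divide_distrib)
      moreover have *: "exp (- (r + m)) * x \<le> exp (- r)" if "x \<le> exp m" for x
      proof -
        have "exp (- (r + m)) * x \<le> exp (- (r + m)) * exp m"
          using that by (intro mult_left_mono) auto
        also have "\<dots> = exp (- r)" by (simp flip: exp_add)
        finally show ?thesis .
      qed
      have "cmod (((?Q1 - P1 z) + (?Q2 - P2 (- z))) / (2 * pi * \<i>)) \<le> exp (- r)"
        by (intro half order_trans[OF P1(3)[OF z]] order_trans[OF P2(3)] * g_norm) (use z in simp)
      ultimately show ?thesis by simp
    qed
    ultimately show ?thesis by blast
  qed
  have "0 \<le> m + C + L * m" using CL m by simp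
  then show ?thesis by (rule that[OF _ CL(2) main])
qed

text \<open>
  Dividing by \<open>E = exp (- \<Lambda> G)\<close> removes the weight: if \<open>l\<close> is large enough, \<open>\<phi> / E\<close> has quadratic decay
  on \<open>V\<^sub>a\<close> and can be approximated by functions bounded on \<open>V\<^sub>K\<close>; multiplying by \<open>E\<close> restores the decay
  \<open>l'\<close>. The number \<open>l\<close> depends on \<open>K\<close> through the constants of \<open>G\<close>.
\<close>

lemma splits_widen:
  assumes w: "weight_function \<omega>" and G: "weight_comparable \<omega> K G"
    and b: "0 < b" "b < a" "a \<le> K" and l': "0 \<le> l'"
  shows "\<exists>l. splits \<omega> a l b l' K l'"
proof -
  obtain c D where cD: "0 < c" "0 < D"
    and Re_G: "\<And>z. z \<in> strip (ereal K) \<Longrightarrow> c * (\<omega> \<bar>Re z\<bar> + 1) \<le> Re (G z)"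
    and cmod_G: "\<And>z. z \<in> strip (ereal K) \<Longrightarrow> cmod (G z) \<le> D * (\<omega> \<bar>Re z\<bar> + 1)"
    and hol_G: "G holomorphic_on strip (ereal K)"
    using G unfolding weight_comparable_def by blast
  define \<Lambda> where "\<Lambda> = l' / c"
  have \<Lambda>: "0 \<le> \<Lambda>" "\<Lambda> * c = l'" using l' cD by (auto simp: \<Lambda>_def)
  define E where "E z = exp (- of_real \<Lambda> * G z)" for z
  have hol_E: "E holomorphic_on strip (ereal K)"
    unfolding E_def by (intro holomorphic_intros hol_G)
  have E_le: "cmod (E z) * exp (l' * \<omega> \<bar>Re z\<bar>) \<le> 1" if z: "z \<in> strip (ereal K)" for z
  proof -
    have "l' * (\<omega> \<bar>Re z\<bar> + 1) \<le> \<Lambda> * Re (G z)"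
      using mult_left_mono[OF Re_G[OF z] \<Lambda>(1)] by (simp add: \<Lambda>(2) flip: mult.assoc)
    then have "l' * \<omega> \<bar>Re z\<bar> \<le> \<Lambda> * Re (G z)" using l' by (simp add: distrib_left)
    then show ?thesis by (simp add: E_def flip: exp_add)
  qed
  have inverse_E_le: "cmod (inverse (E z)) \<le> exp (\<Lambda> * D * (\<omega> \<bar>Re z\<bar> + 1))"
    if z: "z \<in> strip (ereal K)" for z
  proof -
    have "\<Lambda> * Re (G z) \<le> \<Lambda> * (D * (\<omega> \<bar>Re z\<bar> + 1))"
      using \<Lambda>(1) order_trans[OF complex_Re_le_cmod cmod_G[OF z]] by (intro mult_left_mono)
    then show ?thesis by (simp add: E_def norm_inverse exp_minus[symmetric] mult.assoc)
  qed
  obtain B0 where B0: "0 < B0" "\<And>x. exp (- 2 * \<omega> \<bar>x\<bar>) \<le> B0 / (1 + x\<^sup>2)"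
    by (rule weight_dominates_squares[OF w]) (rule that)
  \<comment> \<open>\<open>\<Lambda> D\<close> compensates \<open>1 / E\<close>, and the remaining \<open>2\<close> gives quadratic decay\<close>
  define l where "l = \<Lambda> * D + 2"
  define B where "B = exp (\<Lambda> * D) * B0"
  have B: "0 < B" using B0 by (simp add: B_def)
  obtain C L where CL: "0 \<le> C" "0 \<le> L" and approx:
    "\<And>r F. 0 \<le> r \<Longrightarrow> F holomorphic_on strip (ereal a) \<Longrightarrow>
      \<forall>w\<in>strip (ereal a). cmod (F w) \<le> B / (1 + (Re w)\<^sup>2) \<Longrightarrow>
      \<exists>P. P holomorphic_on strip (ereal K) \<and>
        (\<forall>z\<in>strip (ereal K). cmod (P z) \<le> exp (C + L * r)) \<and>
        (\<forall>z\<in>strip (ereal b). cmod (F z - P z) \<le> exp (- r))"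
    by (rule strip_approximation[OF b B]) (rule that)
  have subK: "z \<in> strip (ereal K)" if "z \<in> strip (ereal a)" for z using that b by simp
  have "splits \<omega> a l b l' K l'"
    unfolding splits_def
  proof (rule exI[of _ C], rule conjI[OF CL(1)], rule exI[of _ L], rule conjI[OF CL(2)], intro allI impI ballI)
    fix r \<phi> assume r: "(0 :: real) \<le> r" and \<phi>: "\<phi> \<in> weighted_ball \<omega> a l 0"
    define F where "F z = \<phi> z * inverse (E z)" for z
    have hol_\<phi>: "\<phi> holomorphic_on strip (ereal a)" using \<phi> by (simp add: weighted_ball_def)
    have hol_E': "E holomorphic_on strip (ereal a)"
      using hol_E by (rule holomorphic_on_subset) (use subK in blast)
    have "F holomorphic_on strip (ereal a)"
      unfolding F_def by (intro holomorphic_intros hol_\<phi> hol_E') (simp add: E_def)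
    moreover have "cmod (F z) \<le> B / (1 + (Re z)\<^sup>2)" if z: "z \<in> strip (ereal a)" for z
    proof -
      have "cmod (\<phi> z) * exp (l * \<omega> \<bar>Re z\<bar>) \<le> 1"
        using \<phi> z by (simp add: weighted_ball_def weighted_abs_def)
      then have "cmod (\<phi> z) \<le> exp (- (l * \<omega> \<bar>Re z\<bar>))"
        by (simp add: exp_minus field_simps)
      then have "cmod (F z) \<le> exp (- (l * \<omega> \<bar>Re z\<bar>)) * exp (\<Lambda> * D * (\<omega> \<bar>Re z\<bar> + 1))"
        unfolding F_def norm_mult using inverse_E_le[OF subK[OF z]] by (intro mult_mono) auto
      also have "\<dots> = exp (\<Lambda> * D) * exp (- 2 * \<omega> \<bar>Re z\<bar>)"
        by (simp add: l_def algebra_simps flip: exp_add)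
      also have "\<dots> \<le> exp (\<Lambda> * D) * (B0 / (1 + (Re z)\<^sup>2))"
        using B0(2) by (intro mult_left_mono) auto
      finally show ?thesis by (simp add: B_def)
    qed
    ultimately obtain P where P: "P holomorphic_on strip (ereal K)"
      "\<And>z. z \<in> strip (ereal K) \<Longrightarrow> cmod (P z) \<le> exp (C + L * r)"
      "\<And>z. z \<in> strip (ereal b) \<Longrightarrow> cmod (F z - P z) \<le> exp (- r)"
      using approx[OF r, of F] by blast
    define \<psi> where "\<psi> z = P z * E z" for z
    have "weighted_abs \<omega> l' \<psi> z \<le> exp (C + L * r)" if z: "z \<in> strip (ereal K)" for z
      using mult_mono[OF P(2)[OF z] E_le[OF z]] by (simp add: weighted_abs_def \<psi>_def norm_mult mult.assoc)
    moreover have "\<psi> holomorphic_on strip (ereal K)"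
      unfolding \<psi>_def by (intro holomorphic_intros P(1) hol_E)
    ultimately have 1: "\<psi> \<in> weighted_ball \<omega> K l' (C + L * r)" by (simp add: weighted_ball_def)
    have "weighted_abs \<omega> l' (\<phi> - \<psi>) z \<le> exp (- r)" if z: "z \<in> strip (ereal b)" for z
    proof -
      have zK: "z \<in> strip (ereal K)" using z b by simp
      have "(\<phi> - \<psi>) z = (F z - P z) * E z" by (simp add: F_def \<psi>_def E_def left_diff_distrib)
      then show ?thesis
        using mult_mono[OF P(3)[OF z] E_le[OF zK]] by (simp add: weighted_abs_def norm_mult mult.assoc)
    qed
    moreover have "(\<phi> - \<psi>) holomorphic_on strip (ereal b)"
    proof -
      have "strip (ereal b) \<subseteq> strip (ereal a)" "strip (ereal b) \<subseteq> strip (ereal K)" using b by auto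
      then have "\<phi> holomorphic_on strip (ereal b)" "\<psi> holomorphic_on strip (ereal b)"
        using hol_\<phi> \<open>\<psi> holomorphic_on strip (ereal K)\<close> holomorphic_on_subset by blast+
      then show ?thesis unfolding fun_diff_def by (rule holomorphic_on_diff)
    qed
    ultimately have 2: "\<phi> - \<psi> \<in> weighted_ball \<omega> b l' (- r)" by (simp add: weighted_ball_def)
    show "\<exists>\<psi>\<in>weighted_ball \<omega> K l' (C + L * r). \<phi> - \<psi> \<in> weighted_ball \<omega> b l' (- r)"
      using 1 2 by blast
  qed
  then show ?thesis ..
qed

text \<open>
  The decay has to be improved before the strip is widened, because the decay that the
  widening needs depends on the target strip, whereas the source space must not. The cost at the
  source is one unit of decay and a slightly wider strip, for every target.
\<close>

lemma splits_condition_A: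
  assumes w: "weight_function \<omega>" and A: "condition_A h \<omega>"
    and b: "0 < b" "b < a" "ereal a < h" and K: "ereal K < h"
  shows "splits \<omega> a l b (l - 1) K l'"
proof -
  define K0 where "K0 = max a K"
  define l0 where "l0 = max l' (max 0 (l - 1))"
  have K0: "0 < K0" "ereal K0 < h" "a \<le> K0" "K \<le> K0" using b K by (auto simp: K0_def max_def)
  obtain Ga where Ga: "weight_comparable \<omega> a Ga"
    using exists_weight_comparable[OF w A _ b(3)] b by auto
  obtain GK where GK: "weight_comparable \<omega> K0 GK"
    using exists_weight_comparable[OF w A K0(1,2)] by blast
  have "0 \<le> l0" by (simp add: l0_def)
  from splits_widen[OF w GK b(1,2) K0(3) this] obtain l1 where l1: "splits \<omega> a l1 b l0 K0 l0" ..
  have "splits \<omega> a l b (l - 1) a l1"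
    using splits_error_mono[OF w splits_decay[OF w Ga]] b by simp
  then have "splits \<omega> a l b (l - 1) K0 l0"
    by (rule splits_trans[OF w _ l1]) (auto simp: l0_def)
  then show ?thesis
    by (rule splits_trans[OF w _ splits_trivial[OF w]]) (use K0 in \<open>auto simp: l0_def\<close>)
qed


section \<open>From strips to the projective limit\<close>

text \<open>
  The large summands constructed so far live on some strip \<open>V\<^sub>k\<close> with \<open>k < h\<close>. The decompositions
  themselves say that the next space is dense in the current one with respect to the weaker norm, so
  a Mittag-Leffler argument applies: correct successively, with errors that sum up, and pass to
  the limit. The limit is holomorphic on all of \<open>V\<^sub>h\<close> and has finite norms of every index.
\<close>

lemma U_space_approximation:
  fixes \<kappa> :: "nat \<Rightarrow> real"
  assumes w: "weight_function \<omega>"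
    and \<kappa>: "\<And>n. ereal (\<kappa> n) < h" "strict_mono \<kappa>" "\<And>k. ereal k < h \<Longrightarrow> \<exists>n. k \<le> \<kappa> n"
    and step: "\<And>n. splits \<omega> (\<kappa> (Suc n)) (real (Suc n) + 1) (\<kappa> n) (real n + 1)
                          (\<kappa> (n + 2)) (real (n + 2) + 1)"
    and \<psi>: "\<psi> \<in> weighted_ball \<omega> (\<kappa> (Suc k)) (real (Suc k) + 1) x"
    and r: "0 \<le> r"
  shows "\<exists>\<eta>\<in>U_space \<omega> h. \<eta> - \<psi> \<in> weighted_ball \<omega> (\<kappa> k) (real k + 1) (- r)"
proof -
  define B where "B n = weighted_ball \<omega> (\<kappa> n) (real n + 1)" for n
  have \<kappa>_mono: "\<kappa> m \<le> \<kappa> n" if "m \<le> n" for m n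
    using \<kappa>(2) that by (simp add: strict_mono_less_eq)
  have B_mono: "\<phi> \<in> B m x" if "\<phi> \<in> B n x" "m \<le> n" for \<phi> m n x
    using weighted_ball_mono[OF w that(1)[unfolded B_def], of "\<kappa> m" "real m + 1" x] \<kappa>_mono[OF that(2)] that(2)
    by (simp add: B_def)
  have "\<exists>f. \<forall>i. ((\<exists>x. f i \<in> B (k + i + 1) x) \<and> (i = 0 \<longrightarrow> f i = \<psi>)) \<and>
          f (Suc i) - f i \<in> B (k + i) (- (r + real i + 1))"
  proof (rule dependent_nat_choice[where
        P = "\<lambda>i f. (\<exists>x. f \<in> B (k + i + 1) x) \<and> (i = 0 \<longrightarrow> f = \<psi>)" and
        Q = "\<lambda>i f g. g - f \<in> B (k + i) (- (r + real i + 1))"])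
    show "\<exists>f. (\<exists>x. f \<in> B (k + 0 + 1) x) \<and> (0 = 0 \<longrightarrow> f = \<psi>)"
      using \<psi> by (auto simp: B_def)
    fix f i assume "(\<exists>x. f \<in> B (k + i + 1) x) \<and> (i = 0 \<longrightarrow> f = \<psi>)"
    then obtain y where y: "f \<in> B (k + i + 1) y" by blast
    have y': "f \<in> B (k + i + 1) (max 0 y)"
      using weighted_ball_mono[OF w y[unfolded B_def], of _ _ "max 0 y"] by (simp add: B_def)
    obtain C L where
      D: "\<And>r x \<phi>. 0 \<le> r + x \<Longrightarrow> \<phi> \<in> B (Suc (k + i)) x \<Longrightarrow>
          \<exists>\<psi>\<in>B (k + i + 2) (x + C + L * (r + x)). \<phi> - \<psi> \<in> B (k + i) (- r)"
      unfolding B_def using step[of "k + i"] by (rule splitsE) metis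
    from D[of "r + real i + 1" "max 0 y" f] y' r obtain g where
      g: "g \<in> B (k + i + 2) (max 0 y + C + L * ((r + real i + 1) + max 0 y))"
        "f - g \<in> B (k + i) (- (r + real i + 1))" by auto
    have "g - f \<in> B (k + i) (- (r + real i + 1))"
      using g(2) unfolding B_def by (rule weighted_ball_minus_commute)
    with g(1) show "\<exists>g. ((\<exists>x. g \<in> B (k + Suc i + 1) x) \<and> (Suc i = 0 \<longrightarrow> g = \<psi>)) \<and>
        g - f \<in> B (k + i) (- (r + real i + 1))" by auto
  qed
  then obtain f where f_B: "\<And>i. \<exists>x. f i \<in> B (k + i + 1) x" and f_0: "f 0 = \<psi>"
    and f_diff: "\<And>i. f (Suc i) - f i \<in> B (k + i) (- (r + real i + 1))" by blast
  have tele: "weighted_abs \<omega> (real (k + i) + 1) (f (i + j) - f i) z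
      \<le> exp (- (r + real i)) - exp (- (r + real (i + j)))"
    if z: "z \<in> strip (ereal (\<kappa> (k + i)))" for i j z
  proof (induction j)
    case 0
    then show ?case by (simp add: weighted_abs_def)
  next
    case (Suc j)
    let ?W = "\<lambda>g. weighted_abs \<omega> (real (k + i) + 1) g z"
    have "f (Suc (i + j)) - f (i + j) \<in> B (k + i) (- (r + real (i + j) + 1))"
      using f_diff[of "i + j"] by (rule B_mono) simp
    then have 1: "?W (f (Suc (i + j)) - f (i + j)) \<le> exp (- (r + real (i + j) + 1))"
      using z by (simp add: B_def weighted_ball_def)
    have 2: "exp (- (r + real (i + j) + 1)) + exp (- (r + real (i + j) + 1))
        \<le> exp (- (r + real (i + j)))"
      by (rule exp_add_exp_le) auto
    have 3: "?W (f (i + Suc j) - f i) \<le> ?W (f (Suc (i + j)) - f (i + j)) + ?W (f (i + j) - f i)"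
      using norm_triangle_ineq[of "f (Suc (i + j)) z - f (i + j) z" "f (i + j) z - f i z"]
      by (simp add: weighted_abs_def flip: distrib_right)
    have 4: "exp (- (r + real (i + j) + 1)) = exp (- (r + real (i + Suc j)))" by simp
    show ?case using Suc.IH 1 2 3 4 by linarith
  qed
  have tele': "cmod (f (i + j) z - f i z) \<le> exp (- (r + real i))"
    if z: "z \<in> strip (ereal (\<kappa> (k + i)))" for i j z
  proof -
    have "cmod (f (i + j) z - f i z) \<le> weighted_abs \<omega> (real (k + i) + 1) (f (i + j) - f i) z"
      using cmod_le_weighted_abs[OF w, of "real (k + i) + 1" "f (i + j) - f i" z] by simp
    with tele[OF z, of j] show ?thesis
      by (smt (verit) exp_gt_zero)
  qed
  have ex_idx: "\<exists>i. z \<in> strip (ereal (\<kappa> (k + i)))" if "z \<in> strip h" for z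
  proof -
    have "ereal \<bar>Im z\<bar> < h" using that by (simp add: strip_def)
    from ereal_dense2[OF this] obtain k' where k': "\<bar>Im z\<bar> < k'" "ereal k' < h"
      unfolding less_ereal.simps by blast
    obtain n where "k' \<le> \<kappa> n" using \<kappa>(3)[OF k'(2)] by blast
    also have "\<kappa> n \<le> \<kappa> (k + n)" by (rule \<kappa>_mono) simp
    finally have "z \<in> strip (ereal (\<kappa> (k + n)))" using k'(1) by simp
    then show ?thesis ..
  qed
  have strip_up: "z \<in> strip (ereal (\<kappa> (k + j)))" if "z \<in> strip (ereal (\<kappa> (k + i)))" "i \<le> j" for z i j
    using that \<kappa>_mono[of "k + i" "k + j"] by auto
  have conv: "convergent (\<lambda>i. f i z)" if z: "z \<in> strip h" for z
  proof -
    obtain i0 where i0: "z \<in> strip (ereal (\<kappa> (k + i0)))" using ex_idx[OF z] by blast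
    have "Cauchy (\<lambda>i. f i z)"
      unfolding Cauchy_altdef
    proof (intro allI impI)
      fix e :: real assume "0 < e"
      have "(\<lambda>i. exp (- (r + real i))) \<longlonglongrightarrow> 0" by real_asymp
      from order_tendstoD(2)[OF this \<open>0 < e\<close>] obtain i1 where
        i1: "\<And>i. i1 \<le> i \<Longrightarrow> exp (- (r + real i)) < e"
        by (auto simp: eventually_sequentially)
      have "dist (f m z) (f n z) < e" if "max i0 i1 \<le> m" "m < n" for m n
        using tele'[of z m "n - m"] i1[of m] that strip_up[OF i0, of m]
        by (simp add: dist_norm norm_minus_commute)
      then show "\<exists>M. \<forall>m\<ge>M. \<forall>n>m. dist (f m z) (f n z) < e" by blast
    qed
    then show ?thesis by (rule Cauchy_convergent)
  qed
  define \<eta> where "\<eta> z = (if z \<in> strip h then lim (\<lambda>i. f i z) else 0)" for z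
  have lim: "(\<lambda>i. f i z) \<longlonglongrightarrow> \<eta> z" if "z \<in> strip h" for z
    using conv[OF that] that by (simp add: \<eta>_def convergent_LIMSEQ_iff)
  have sub_h: "strip (ereal (\<kappa> n)) \<subseteq> strip h" for n
    using \<kappa>(1)[of n] by (intro strip_mono) simp
  have \<eta>_bound: "weighted_abs \<omega> (real (k + i) + 1) (\<eta> - f i) z \<le> exp (- (r + real i))"
    if z: "z \<in> strip (ereal (\<kappa> (k + i)))" for i z
  proof -
    have "z \<in> strip h" using z sub_h by blast
    from LIMSEQ_ignore_initial_segment[OF lim[OF this], of i]
    have "(\<lambda>j. f (i + j) z) \<longlonglongrightarrow> \<eta> z" by (simp only: add.commute)
    then have "(\<lambda>j. weighted_abs \<omega> (real (k + i) + 1) (f (i + j) - f i) z)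
        \<longlonglongrightarrow> weighted_abs \<omega> (real (k + i) + 1) (\<eta> - f i) z"
      unfolding weighted_abs_def minus_apply by (intro tendsto_intros)
    moreover have "weighted_abs \<omega> (real (k + i) + 1) (f (i + j) - f i) z \<le> exp (- (r + real i))" for j
      using tele[OF z, of j] exp_gt_zero[of "- (r + real (i + j))"] by linarith
    ultimately show ?thesis by (intro LIMSEQ_le_const2) auto
  qed
  have hol_f: "f i holomorphic_on strip (ereal (\<kappa> (k + i)))" for i
    using f_B[of i] holomorphic_on_subset[OF _ strip_mono[of "ereal (\<kappa> (k+i))" "ereal (\<kappa> (k+i+1))"]] \<kappa>_mono[of "k+i" "k+i+1"]
    by (auto simp: B_def weighted_ball_def)
  have hol: "\<eta> holomorphic_on strip (ereal (\<kappa> (k + i)))" for i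
  proof (rule holomorphic_uniform_sequence[OF open_strip, of "\<lambda>j. f (i + j)"])
    show "f (i + j) holomorphic_on strip (ereal (\<kappa> (k + i)))" for j
      using hol_f[of "i + j"] holomorphic_on_subset[OF _ strip_mono[of "ereal (\<kappa> (k+i))" "ereal (\<kappa> (k+(i+j)))"]] \<kappa>_mono[of "k+i" "k+(i+j)"]
      by auto
    fix z assume z: "z \<in> strip (ereal (\<kappa> (k + i)))"
    obtain d where d: "0 < d" "cball z d \<subseteq> strip (ereal (\<kappa> (k + i)))"
      using open_contains_cball[of "strip (ereal (\<kappa> (k + i)))"] open_strip z by blast
    have "uniform_limit (cball z d) (\<lambda>j. f (i + j)) \<eta> sequentially"
    proof (rule uniform_limitI)
      fix e :: real assume "0 < e"
      have "(\<lambda>j. exp (- (r + real (i + j)))) \<longlonglongrightarrow> 0" by real_asymp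
      from order_tendstoD(2)[OF this \<open>0 < e\<close>]
      show "\<forall>\<^sub>F j in sequentially. \<forall>y\<in>cball z d. dist (f (i + j) y) (\<eta> y) < e"
      proof eventually_elim
        case (elim j)
        have "dist (f (i + j) y) (\<eta> y) < e" if "y \<in> cball z d" for y
        proof -
          have y: "y \<in> strip (ereal (\<kappa> (k + (i + j))))"
            using d(2) that strip_up[of y i "i + j"] by auto
          have "cmod (\<eta> y - f (i + j) y) \<le> weighted_abs \<omega> (real (k + (i + j)) + 1) (\<eta> - f (i + j)) y"
            using cmod_le_weighted_abs[OF w, of "real (k + (i + j)) + 1" "\<eta> - f (i + j)" y] by simp
          with \<eta>_bound[OF y] elim show ?thesis by (simp add: dist_norm norm_minus_commute)
        qed
        then show ?case by blast
      qed
    qed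
    with d show "\<exists>d>0. cball z d \<subseteq> strip (ereal (\<kappa> (k + i))) \<and>
        uniform_limit (cball z d) (\<lambda>j. f (i + j)) \<eta> sequentially" by blast
  qed
  have \<eta>_B: "\<exists>x. \<eta> \<in> B (k + i) x" for i
  proof -
    obtain x where "f i \<in> B (k + i + 1) x" using f_B by blast
    then have "f i \<in> B (k + i) x" by (rule B_mono) simp
    moreover have "\<eta> - f i \<in> B (k + i) (- (r + real i))"
      using \<eta>_bound hol[of i] hol_f[of i]
      by (auto simp: B_def weighted_ball_def fun_diff_def intro: holomorphic_intros)
    ultimately have "\<eta> - f i + f i \<in> B (k + i) (max x (- (r + real i)) + 1)"
      unfolding B_def by (intro weighted_ball_add[rotated]) auto
    then show ?thesis by auto
  qed
  have "\<eta> \<in> U_space \<omega> h"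
    unfolding U_space_def
  proof (intro CollectI conjI allI impI)
    show "\<eta> holomorphic_on strip h"
    proof -
      have "\<eta> holomorphic_on (\<Union>i. strip (ereal (\<kappa> (k + i))))"
        by (rule holomorphic_on_UN_open) (auto simp: hol open_strip)
      then show ?thesis by (rule holomorphic_on_subset) (use ex_idx in blast)
    qed
    show "\<eta> z = 0" if "z \<notin> strip h" for z using that by (simp add: \<eta>_def)
    fix k' l assume "0 < k' \<and> ereal k' < h \<and> 0 < (l::real)"
    then obtain n where n: "k' \<le> \<kappa> n" using \<kappa>(3) by blast
    define i where "i = max n (nat \<lceil>l\<rceil>)"
    obtain x where "\<eta> \<in> B (k + i) x" using \<eta>_B by blast
    then have "\<eta> \<in> weighted_ball \<omega> k' l x"
      unfolding B_def
    proof (rule weighted_ball_mono[OF w])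
      have "n \<le> k + i" by (simp add: i_def max_def)
      from \<kappa>_mono[OF this] n show "k' \<le> \<kappa> (k + i)" by linarith
      show "l \<le> real (k + i) + 1" unfolding i_def by linarith
    qed simp
    then show "bdd_above (weighted_abs \<omega> l \<eta> ` strip (ereal k'))"
      by (auto simp: weighted_ball_def)
  qed
  moreover have "\<eta> - \<psi> \<in> weighted_ball \<omega> (\<kappa> k) (real k + 1) (- r)"
    using \<eta>_bound[of _ 0] hol[of 0] hol_f[of 0] f_0
    by (auto simp: weighted_ball_def fun_diff_def intro: holomorphic_intros)
  ultimately show ?thesis by blast
qed


section \<open>Neighbourhoods of zero\<close>

lemma exhausting_sequence:
  assumes "0 < h"
  obtains \<kappa> :: "nat \<Rightarrow> real" where "\<And>n. 0 < \<kappa> n" "\<And>n. ereal (\<kappa> n) < h" "strict_mono \<kappa>"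
    "\<And>k. ereal k < h \<Longrightarrow> \<exists>n. k \<le> \<kappa> n"
proof (cases h)
  case (real c)
  then have c: "0 < c" using assms by simp
  define \<kappa> where "\<kappa> n = c - c / (real n + 2)" for n :: nat
  show ?thesis
  proof (rule that[of \<kappa>])
    show "0 < \<kappa> n" for n using c by (simp add: \<kappa>_def field_simps add_pos_nonneg)
    show "ereal (\<kappa> n) < h" for n using c by (simp add: \<kappa>_def real)
    show "strict_mono \<kappa>"
      using c by (intro strict_monoI) (auto simp: \<kappa>_def intro!: divide_strict_left_mono)
    fix k assume "ereal k < h"
    then have k: "0 < c - k" by (simp add: real)
    obtain n where "c / (c - k) \<le> real n" using real_arch_simple by blast
    then have "c \<le> (real n + 2) * (c - k)" using k c by (simp add: field_simps)
    then have "c / (real n + 2) \<le> c - k" by (simp add: field_simps)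
    then show "\<exists>n. k \<le> \<kappa> n" unfolding \<kappa>_def by (intro exI[of _ n]) linarith
  qed
next
  case PInf
  show ?thesis
  proof (rule that[of "\<lambda>n. real n + 1"])
    show "\<exists>n. k \<le> real n + 1" for k
      using real_arch_simple[of k] by (meson add_increasing2 zero_le_one)
  qed (auto simp: PInf strict_mono_def)
qed (use assms in auto)

lemma weighted_norm_le_iff:
  assumes "\<phi> \<in> U_space \<omega> h" "0 < k" "ereal k < h" "0 < l"
  shows "weighted_norm \<omega> k l \<phi> \<le> M \<longleftrightarrow> (\<forall>z\<in>strip (ereal k). weighted_abs \<omega> l \<phi> z \<le> M)"
proof -
  have "0 \<in> strip (ereal k)" using assms(2) by simp
  then have "strip (ereal k) \<noteq> {}" by blast
  moreover have "bdd_above (weighted_abs \<omega> l \<phi> ` strip (ereal k))"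
    using assms by (simp add: U_space_def)
  ultimately show ?thesis unfolding weighted_norm_def by (rule cSUP_le_iff)
qed

lemma U_space_lincomb:
  assumes "\<phi> \<in> U_space \<omega> h" "\<psi> \<in> U_space \<omega> h"
  shows "fun_scale a \<phi> + fun_scale b \<psi> \<in> U_space \<omega> h"
proof -
  have "bdd_above (weighted_abs \<omega> l (fun_scale a \<phi> + fun_scale b \<psi>) ` strip (ereal k))"
    if kl: "0 < k \<and> ereal k < h \<and> 0 < l" for k l
  proof -
    have "bdd_above (weighted_abs \<omega> l \<phi> ` strip (ereal k))"
      using assms(1) kl by (simp add: U_space_def)
    then obtain M where M: "\<And>z. z \<in> strip (ereal k) \<Longrightarrow> weighted_abs \<omega> l \<phi> z \<le> M"
      unfolding bdd_above_def by blast
    have "bdd_above (weighted_abs \<omega> l \<psi> ` strip (ereal k))"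
      using assms(2) kl by (simp add: U_space_def)
    then obtain N where N: "\<And>z. z \<in> strip (ereal k) \<Longrightarrow> weighted_abs \<omega> l \<psi> z \<le> N"
      unfolding bdd_above_def by blast
    have "weighted_abs \<omega> l (fun_scale a \<phi> + fun_scale b \<psi>) z \<le> cmod a * M + cmod b * N"
      if z: "z \<in> strip (ereal k)" for z
    proof -
      have "weighted_abs \<omega> l (fun_scale a \<phi> + fun_scale b \<psi>) z
          \<le> cmod a * weighted_abs \<omega> l \<phi> z + cmod b * weighted_abs \<omega> l \<psi> z"
        using mult_right_mono[OF norm_triangle_ineq[of "a * \<phi> z" "b * \<psi> z"], of "exp (l * \<omega> \<bar>Re z\<bar>)"]
        by (simp add: weighted_abs_def fun_scale_def norm_mult distrib_right mult.assoc)
      also have "\<dots> \<le> cmod a * M + cmod b * N"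
        using M[OF z] N[OF z] by (intro add_mono mult_left_mono) auto
      finally show ?thesis .
    qed
    then show ?thesis by (auto intro!: bdd_aboveI)
  qed
  moreover have "(fun_scale a \<phi> + fun_scale b \<psi>) holomorphic_on strip h"
    using assms by (auto simp: U_space_def fun_scale_def plus_fun_def intro!: holomorphic_intros)
  ultimately show ?thesis using assms by (auto simp: U_space_def fun_scale_def)
qed

text \<open>
  The topology is generated by balls with arbitrary centres, but only neighbourhoods of zero are compared,
  and a generating ball that contains zero contains a small ball around zero by the triangle
  inequality. The radii \<open>exp (- n)\<close> shrink because the norms with larger index do not dominate arbitrary
  multiples of the smaller ones.
\<close>

lemma fundamental_sequence_weighted_balls:
  fixes \<kappa> :: "nat \<Rightarrow> real"
  assumes h: "0 < h" and w: "weight_function \<omega>"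
    and \<kappa>: "\<And>n. 0 < \<kappa> n" "\<And>n. ereal (\<kappa> n) < h" "strict_mono \<kappa>" "\<And>k. ereal k < h \<Longrightarrow> \<exists>n. k \<le> \<kappa> n"
  shows "fundamental_sequence fun_scale (U_topology \<omega> h)
    (\<lambda>n. U_space \<omega> h \<inter> weighted_ball \<omega> (\<kappa> n) (real n + 1) (- real n))"
proof -
  define U where "U n = U_space \<omega> h \<inter> weighted_ball \<omega> (\<kappa> n) (real n + 1) (- real n)" for n
  have zero: "0 \<in> U_space \<omega> h"
    by (auto simp: U_space_def weighted_abs_def zero_fun_def intro!: bdd_aboveI)
  have hol: "\<phi> holomorphic_on strip (ereal k)" if "\<phi> \<in> U_space \<omega> h" "ereal k < h" for \<phi> k
  proof -
    have "\<phi> holomorphic_on strip h" using that(1) by (simp add: U_space_def)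
    then show ?thesis by (rule holomorphic_on_subset) (rule strip_mono, use that(2) in simp)
  qed
  have U_mono: "U n \<subseteq> U m" if "m \<le> n" for m n
    using that weighted_ball_mono[OF w, of _ "\<kappa> n" "real n + 1" "- real n" "\<kappa> m" "real m + 1" "- real m"] \<kappa>(3)
    by (auto simp: U_def strict_mono_less_eq)
  have zero_nbhd: "zero_neighbourhood (U_topology \<omega> h) (U n)" for n
  proof -
    define W where "W = {\<psi> \<in> U_space \<omega> h. weighted_norm \<omega> (\<kappa> n) (real n + 1) (\<psi> - 0) < exp (- real n)}"
    have "openin (U_topology \<omega> h) W"
      unfolding U_topology_def
      by (rule topology_generated_by_Basis, unfold W_def mem_Collect_eq,
          rule exI[of _ 0], rule exI[of _ "\<kappa> n"], rule exI[of _ "real n + 1"], rule exI[of _ "exp (- real n)"])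
         (use \<kappa> zero in simp)
    moreover have "0 \<in> W"
    proof -
      have "weighted_norm \<omega> (\<kappa> n) (real n + 1) 0 \<le> 0"
        using \<kappa> zero by (subst weighted_norm_le_iff) (auto simp: weighted_abs_def)
      also have "\<dots> < exp (- real n)" by simp
      finally show ?thesis using zero by (simp add: W_def)
    qed
    moreover have "W \<subseteq> U n"
    proof
      fix \<psi> assume \<psi>: "\<psi> \<in> W"
      then have "\<psi> \<in> U_space \<omega> h" "weighted_norm \<omega> (\<kappa> n) (real n + 1) \<psi> \<le> exp (- real n)"
        by (auto simp: W_def)
      then show "\<psi> \<in> U n"
        using hol[OF _ \<kappa>(2)] weighted_norm_le_iff[OF _ \<kappa>(1,2), of \<psi> \<omega> "real n + 1"]
        by (auto simp: U_def weighted_ball_def)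
    qed
    ultimately show ?thesis
      unfolding zero_neighbourhood_def topspace_U_topology[OF h] by (auto simp: U_def)
  qed
  have conv: "absolutely_convex fun_scale (U n)" for n
    unfolding absolutely_convex_def
  proof (intro ballI allI impI)
    fix \<phi> \<psi> and a b :: complex
    assume \<phi>\<psi>: "\<phi> \<in> U n" "\<psi> \<in> U n" and ab: "cmod a + cmod b \<le> 1"
    have mem: "fun_scale a \<phi> + fun_scale b \<psi> \<in> U_space \<omega> h"
      using \<phi>\<psi> by (intro U_space_lincomb) (auto simp: U_def)
    have "weighted_abs \<omega> (real n + 1) (fun_scale a \<phi> + fun_scale b \<psi>) z \<le> exp (- real n)"
      if z: "z \<in> strip (ereal (\<kappa> n))" for z
    proof -
      have "weighted_abs \<omega> (real n + 1) (fun_scale a \<phi> + fun_scale b \<psi>) z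
          \<le> cmod a * weighted_abs \<omega> (real n + 1) \<phi> z + cmod b * weighted_abs \<omega> (real n + 1) \<psi> z"
        using mult_right_mono[OF norm_triangle_ineq[of "a * \<phi> z" "b * \<psi> z"], of "exp ((real n + 1) * \<omega> \<bar>Re z\<bar>)"]
        by (simp add: weighted_abs_def fun_scale_def norm_mult distrib_right mult.assoc)
      also have "\<dots> \<le> cmod a * exp (- real n) + cmod b * exp (- real n)"
        using \<phi>\<psi> z by (intro add_mono mult_left_mono) (auto simp: U_def weighted_ball_def)
      also have "\<dots> \<le> 1 * exp (- real n)"
        using ab by (simp flip: distrib_right)
      finally show ?thesis by simp
    qed
    with mem hol[OF mem \<kappa>(2)] show "fun_scale a \<phi> + fun_scale b \<psi> \<in> U n"
      by (simp add: U_def weighted_ball_def)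
  qed
  have base: "\<exists>n. U n \<subseteq> W" if W: "openin (U_topology \<omega> h) W" and "0 \<in> W" for W
  proof -
    have "generate_topology_on {{\<psi> \<in> U_space \<omega> h. weighted_norm \<omega> k l (\<psi> - \<phi>) < \<epsilon>} | \<phi> k l \<epsilon>.
          \<phi> \<in> U_space \<omega> h \<and> 0 < k \<and> ereal k < h \<and> 0 < l \<and> 0 < \<epsilon>} W"
      using W unfolding U_topology_def by (simp add: openin_topology_generated_by_iff)
    then show ?thesis
      using \<open>0 \<in> W\<close>
    proof (induction rule: generate_topology_on.induct)
      case (Int V W)
      then obtain m n where "U m \<subseteq> V" "U n \<subseteq> W" by blast
      then have "U (max m n) \<subseteq> V \<inter> W" using U_mono[of m "max m n"] U_mono[of n "max m n"] by auto
      then show ?case by blast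
    next
      case (UN \<V>)
      then show ?case by blast
    next
      case (Basis V)
      then obtain \<phi> k l \<epsilon> where V: "V = {\<psi> \<in> U_space \<omega> h. weighted_norm \<omega> k l (\<psi> - \<phi>) < \<epsilon>}"
        and \<phi>: "\<phi> \<in> U_space \<omega> h" and kl: "0 < k" "ereal k < h" "0 < l" by blast
      have minus: "\<psi> - \<phi> \<in> U_space \<omega> h" if "\<psi> \<in> U_space \<omega> h" for \<psi>
      proof -
        have "fun_scale 1 \<psi> + fun_scale (- 1) \<phi> = \<psi> - \<phi>" by (auto simp: fun_scale_def)
        then show ?thesis using U_space_lincomb[OF that \<phi>, of 1 "- 1"] by simp
      qed
      define \<delta> where "\<delta> = weighted_norm \<omega> k l (0 - \<phi>)"
      have \<delta>: "\<delta> < \<epsilon>" using Basis.prems unfolding V \<delta>_def mem_Collect_eq by (rule conjunct2)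
      have \<phi>_le: "weighted_abs \<omega> l \<phi> z \<le> \<delta>" if "z \<in> strip (ereal k)" for z
        using weighted_norm_le_iff[OF minus[OF zero] kl, of \<delta>] that
        by (auto simp: \<delta>_def weighted_abs_def)
      have lim: "(\<lambda>n. exp (- real n)) \<longlonglongrightarrow> 0" by real_asymp
      have "0 < \<epsilon> - \<delta>" using \<delta> by simp
      from order_tendstoD(2)[OF lim this] obtain n0 where n0: "exp (- real n0) < \<epsilon> - \<delta>"
        by (auto simp: eventually_sequentially)
      obtain n1 where n1: "k \<le> \<kappa> n1" using \<kappa>(4)[OF kl(2)] by blast
      obtain n2 where n2: "l \<le> real n2" using real_arch_simple by blast
      define n where "n = max n0 (max n1 n2)"
      have n: "n0 \<le> n" "n1 \<le> n" "n2 \<le> n" by (auto simp: n_def)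
      have "\<psi> \<in> V" if \<psi>: "\<psi> \<in> U n" for \<psi>
      proof -
        have \<psi>_U: "\<psi> \<in> U_space \<omega> h" using \<psi> by (simp add: U_def)
        have "\<psi> \<in> weighted_ball \<omega> k l (- real n0)"
        proof (rule weighted_ball_mono[OF w])
          show "\<psi> \<in> weighted_ball \<omega> (\<kappa> n) (real n + 1) (- real n)" using \<psi> by (simp add: U_def)
          have "\<kappa> n1 \<le> \<kappa> n" using n \<kappa>(3) by (simp add: strict_mono_less_eq)
          then show "k \<le> \<kappa> n" using n1 by simp
        qed (use n n2 in auto)
        then have \<psi>_le: "weighted_abs \<omega> l \<psi> z \<le> exp (- real n0)" if "z \<in> strip (ereal k)" for z
          using that by (simp add: weighted_ball_def)
        have "weighted_abs \<omega> l (\<psi> - \<phi>) z \<le> exp (- real n0) + \<delta>" if z: "z \<in> strip (ereal k)" for z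
        proof -
          have "weighted_abs \<omega> l (\<psi> - \<phi>) z \<le> weighted_abs \<omega> l \<psi> z + weighted_abs \<omega> l \<phi> z"
            by (simp add: weighted_abs_def norm_triangle_ineq4 flip: distrib_right)
          with \<psi>_le[OF z] \<phi>_le[OF z] show ?thesis by linarith
        qed
        then have "weighted_norm \<omega> k l (\<psi> - \<phi>) \<le> exp (- real n0) + \<delta>"
          using weighted_norm_le_iff[OF minus[OF \<psi>_U] kl] by blast
        then show ?thesis using n0 \<psi>_U by (simp add: V)
      qed
      then show ?case by blast
    qed auto
  qed
  have "fundamental_sequence fun_scale (U_topology \<omega> h) U"
    unfolding fundamental_sequence_def
  proof (intro conjI allI impI zero_nbhd conv)
    show "decseq U" using U_mono by (auto simp: antimono_def)
    show "\<exists>n. U n \<subseteq> W" if "zero_neighbourhood (U_topology \<omega> h) W" for W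
      using that base unfolding zero_neighbourhood_def by (meson order_trans)
  qed
  then show ?thesis unfolding U_def[abs_def] .
qed

theorem proposition3p1:
  fixes h :: ereal and \<omega> :: "real \<Rightarrow> real"
  assumes "0 < h"
    and "weight_function \<omega>"
    and "condition_A h \<omega>"
  shows "satisfies_Omega fun_scale (U_topology \<omega> h)"
proof -
  note w = assms(2)
  obtain \<kappa> :: "nat \<Rightarrow> real" where \<kappa>: "\<And>n. 0 < \<kappa> n" "\<And>n. ereal (\<kappa> n) < h" "strict_mono \<kappa>"
    "\<And>k. ereal k < h \<Longrightarrow> \<exists>n. k \<le> \<kappa> n"
    by (rule exhausting_sequence[OF assms(1)]) (rule that)
  define B where "B n = weighted_ball \<omega> (\<kappa> n) (real n + 1)" for n
  define U where "U n = U_space \<omega> h \<inter> B n (- real n)" for n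
  have \<kappa>_less: "\<kappa> n < \<kappa> (Suc n)" for n using \<kappa>(3) by (simp add: strict_mono_less)
  have splits: "splits \<omega> (\<kappa> (Suc n)) (real (Suc n) + 1) (\<kappa> n) (real n + 1) (\<kappa> j) (real j + 1)" for n j
    using splits_condition_A[OF w assms(3) \<kappa>(1)[of n] \<kappa>_less[of n] \<kappa>(2)[of "Suc n"] \<kappa>(2)[of j],
        where l = "real (Suc n) + 1" and l' = "real j + 1"]
    by (simp add: add_ac)
  \<comment> \<open>the large summand comes from index \<open>Suc k\<close>, so that its correction to an element of the Frechet space is controlled at index \<open>k\<close>\<close>
  have decompose: "\<exists>C\<ge>0. \<exists>L\<ge>0. \<forall>r\<ge>0. \<forall>\<phi>\<in>B (Suc n) 0.
      \<exists>\<psi>\<in>U_space \<omega> h \<inter> B k (C + L * r). \<phi> - \<psi> \<in> B n (- r)" if k: "n \<le> k" for n k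
  proof -
    obtain C L where CL: "0 \<le> C" "0 \<le> L" and
      D: "\<And>r \<phi>. 0 \<le> r \<Longrightarrow> \<phi> \<in> B (Suc n) 0 \<Longrightarrow>
        \<exists>\<psi>\<in>B (Suc k) (C + L * r). \<phi> - \<psi> \<in> B n (- r)"
      using splits[of n "Suc k"] unfolding splits_def B_def by blast
    have "\<exists>\<psi>\<in>U_space \<omega> h \<inter> B k ((C + L + 1) + L * r). \<phi> - \<psi> \<in> B n (- r)"
      if r: "0 \<le> r" and \<phi>: "\<phi> \<in> B (Suc n) 0" for r \<phi>
    proof -
      have r1: "0 \<le> r + 1" using r by simp
      obtain \<psi>0 where \<psi>0: "\<psi>0 \<in> B (Suc k) (C + L * (r + 1))" "\<phi> - \<psi>0 \<in> B n (- (r + 1))"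
        using D[OF r1 \<phi>] by blast
      obtain \<psi> where \<psi>: "\<psi> \<in> U_space \<omega> h" "\<psi> - \<psi>0 \<in> B k (- (r + 1))"
        using U_space_approximation[OF w \<kappa>(2,3,4) splits \<psi>0(1)[unfolded B_def] r1] unfolding B_def by blast
      have "\<psi>0 \<in> B k (C + L * (r + 1))"
        using weighted_ball_mono[OF w \<psi>0(1)[unfolded B_def], of "\<kappa> k" "real k + 1"] \<kappa>_less[of k] by (simp add: B_def)
      moreover have "0 \<le> L * (r + 1)" using CL r by simp
      then have "- (r + 1) \<le> (C + L + 1) + L * r - 1" "C + L * (r + 1) \<le> (C + L + 1) + L * r - 1"
        using CL(1) r by (simp_all add: distrib_left)
      ultimately have "(\<psi> - \<psi>0) + \<psi>0 \<in> B k ((C + L + 1) + L * r)"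
        using \<psi>(2) unfolding B_def by (intro weighted_ball_add[of "\<psi> - \<psi>0"])
      moreover have "\<psi>0 - \<psi> \<in> B n (- (r + 1))"
      proof -
        have "\<psi>0 - \<psi> \<in> B k (- (r + 1))"
          using \<psi>(2) unfolding B_def by (rule weighted_ball_minus_commute)
        moreover have "\<kappa> n \<le> \<kappa> k" using k \<kappa>(3) by (simp add: strict_mono_less_eq)
        ultimately show ?thesis
          using weighted_ball_mono[OF w, of "\<psi>0 - \<psi>" "\<kappa> k" "real k + 1" "- (r + 1)" "\<kappa> n" "real n + 1"] k
          by (simp add: B_def)
      qed
      then have "(\<phi> - \<psi>0) + (\<psi>0 - \<psi>) \<in> B n (- r)"
        using weighted_ball_add[OF \<psi>0(2)[unfolded B_def], of "\<psi>0 - \<psi>"] by (simp add: B_def)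
      ultimately show ?thesis using \<psi>(1) by auto
    qed
    with CL show ?thesis by (intro exI[of _ "C + L + 1"] exI[of _ L] conjI) auto
  qed
  have "Omega_seq fun_scale U"
    unfolding Omega_seq_def
  proof (intro allI exI[of _ "Suc _"] conjI impI)
    fix n k assume k: "Suc n \<le> k"
    obtain C L where CL: "0 \<le> C" "0 \<le> L" and
      D: "\<And>r \<phi>. 0 \<le> r \<Longrightarrow> \<phi> \<in> B (Suc n) 0 \<Longrightarrow>
        \<exists>\<psi>\<in>U_space \<omega> h \<inter> B k (C + L * r). \<phi> - \<psi> \<in> B n (- r)"
      using decompose[of n k] k by auto
    define C' where "C' = exp (C + L * real n + real k)"
    have "U (Suc n) \<subseteq> fun_scale (of_real (exp (- r))) ` U n
        + fun_scale (of_real (C' * exp ((L + 1) * r))) ` U k" if r: "0 < r" for r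
    proof
      fix \<phi> assume \<phi>: "\<phi> \<in> U (Suc n)"
      then have "\<phi> \<in> B (Suc n) 0"
        using weighted_ball_mono[OF w, of \<phi> "\<kappa> (Suc n)" "real (Suc n) + 1" "- real (Suc n)"]
        by (simp add: U_def B_def)
      moreover have "0 \<le> r + real n" using r by simp
      ultimately obtain \<psi> where \<psi>: "\<psi> \<in> U_space \<omega> h" "\<psi> \<in> B k (C + L * (r + real n))"
        "\<phi> - \<psi> \<in> B n (- (r + real n))" using D by blast
      \<comment> \<open>\<open>L + 1\<close> instead of \<open>L\<close> because the factor in \<open>(\<Omega>)\<close> must be positive\<close>
      define y where "y = C + L * real n + real k + (L + 1) * r"
      have scale_U: "fun_scale (of_real (exp x)) \<eta> \<in> U_space \<omega> h" if "\<eta> \<in> U_space \<omega> h" for \<eta> x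
        using U_space_lincomb[OF that that, of "of_real (exp x)" 0] by (simp add: fun_scale_def plus_fun_def)
      have inv: "fun_scale (of_real (exp x)) (fun_scale (of_real (exp (- x))) \<eta>) = \<eta>" for x \<eta>
      proof -
        have "of_real (exp x) * of_real (exp (- x)) = (1 :: complex)"
          by (simp flip: of_real_mult exp_add)
        then show ?thesis by (simp add: fun_scale_def flip: mult.assoc)
      qed
      have "\<phi> - \<psi> \<in> U_space \<omega> h"
      proof -
        have "fun_scale 1 \<phi> + fun_scale (- 1) \<psi> = \<phi> - \<psi>" by (auto simp: fun_scale_def)
        then show ?thesis using U_space_lincomb[OF _ \<psi>(1), of \<phi> 1 "- 1"] \<phi> by (simp add: U_def)
      qed
      moreover have "fun_scale (of_real (exp r)) (\<phi> - \<psi>) \<in> B n (- real n)"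
        using weighted_ball_scale[OF \<psi>(3)[unfolded B_def], of r] by (simp add: B_def)
      ultimately have "fun_scale (of_real (exp r)) (\<phi> - \<psi>) \<in> U n"
        using scale_U by (simp add: U_def)
      then have 1: "\<phi> - \<psi> \<in> fun_scale (of_real (exp (- r))) ` U n"
        using inv[of "- r" "\<phi> - \<psi>"] by (metis image_eqI minus_minus)
      have "fun_scale (of_real (exp (- y))) \<psi> \<in> B k (- real k)"
      proof -
        have "fun_scale (of_real (exp (- y))) \<psi> \<in> B k (C + L * (r + real n) + - y)"
          using weighted_ball_scale[OF \<psi>(2)[unfolded B_def], of "- y"] by (simp add: B_def)
        then show ?thesis
          unfolding B_def
          by (rule weighted_ball_mono[OF w]) (use r in \<open>auto simp: y_def algebra_simps\<close>)
      qed
      then have "fun_scale (of_real (exp (- y))) \<psi> \<in> U k"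
        using scale_U[OF \<psi>(1)] by (simp add: U_def)
      then have "\<psi> \<in> fun_scale (of_real (exp y)) ` U k"
        using inv[of y \<psi>] by (metis image_eqI)
      moreover have "exp y = C' * exp ((L + 1) * r)" by (simp add: y_def C'_def flip: exp_add)
      ultimately have 2: "\<psi> \<in> fun_scale (of_real (C' * exp ((L + 1) * r))) ` U k" by simp
      have "\<phi> = (\<phi> - \<psi>) + \<psi>" by simp
      then show "\<phi> \<in> fun_scale (of_real (exp (- r))) ` U n
          + fun_scale (of_real (C' * exp ((L + 1) * r))) ` U k"
        using set_plus_intro[OF 1 2] by simp
    qed
    moreover have "0 < C'" "0 < L + 1" using CL by (auto simp: C'_def)
    ultimately show "\<exists>C>0. \<exists>L>0. \<forall>r>0. U (Suc n) \<subseteq> fun_scale (of_real (exp (- r))) ` U n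
        + fun_scale (of_real (C * exp (L * r))) ` U k" by blast
  qed simp
  moreover have "fundamental_sequence fun_scale (U_topology \<omega> h) U"
    unfolding U_def[abs_def] B_def by (rule fundamental_sequence_weighted_balls[OF assms(1) w \<kappa>])
  ultimately show ?thesis unfolding satisfies_Omega_def by blast
qed

end
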